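(* Let $m\ge1$, let $S_m=\{s_1,\dots,s_m\}$, $T_m=\{t_1,\dots,t_m\}$ be two disjoint sets of $m$ symbols, and let $B_{S_m,T_m}=(b_{s_it_j})_{1\le i,j\le m}$ be the generic matrix in the symmetric symbols $b_{uv}=b_{vu}$. If $m$ is odd, then the fully antisymmetrised permanent $\operatorname{perm}B_{[S_m,T_m]}$ vanishes. If $m$ is even, then $$\operatorname{perm}B_{[S_m,T_m]}=\sum_{k=1}^{m/2}(-2)^k\,k!\sum_{\{\{I_1,J_1\},\dots,\{I_k,J_k\}\}\in\mathcal{D}_m^k}\ \prod_{l=1}^k\det\bigl(B_{S_{I_l}\cup T_{I_l},\,S_{J_l}\cup T_{J_l}}\bigr).$$
   Context: Work in the polynomial ring over $\mathbb{Z}$ generated by symbols $b_{uv}$, $u,v\in S_m\cup T_m$, subject to $b_{uv}=b_{vu}$. For lists $U,V$ of the same length, $B_{U,V}=(b_{uv})_{u\in U,v\in V}$. Let $g_i$ be the involution of $S_m\cup T_m$ interchanging $s_i$ and $t_i$ and fixing everything else; $g_1,\dots,g_m$ generate a group $G_m\cong(\mathbb{Z}/2\mathbb{Z})^m$ acting on the polynomial ring by permuting indices. Let $\chi:G_m\to\{\pm1\}$ be the character with $\chi(g_i)=-1$ for all $i$. The fully antisymmetrised permanent is $\operatorname{perm}B_{[S_m,T_m]}=\sum_{g\in G_m}\chi(g)\,g\bigl(\operatorname{perm}B_{S_m,T_m}\bigr)$. For $m$ even, $\mathcal{D}_m^k$ is the set of unordered $k$-tuples $\{\{I_1,J_1\},\dots,\{I_k,J_k\}\}$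 of unordered pairs of non-empty sets such that $\{1,\dots,m\}$ is the disjoint union of $I_1,\dots,I_k,J_1,\dots,J_k$ and $|I_l|=|J_l|$ for all $l$. For $I=\{i_1<\dots<i_k\}$, the set $S_I\cup T_I$ is given the order $s_{i_1},t_{i_1},\dots,s_{i_k},t_{i_k}$. *)

theory Defs
  imports
    "HOL-Library.Poly_Mapping"
    "HOL-Library.Uprod"
    "HOL-Library.Disjoint_Sets"
    "HOL-Algebra.Generated_Groups"
    "HOL-Algebra.Sym_Groups"
    "Jordan_Normal_Form.Determinant"
begin

datatype symb = S nat | T nat

definition S_list :: "nat \<Rightarrow> symb list" where
  "S_list m = map S [1..<Suc m]"

definition T_list :: "nat \<Rightarrow> symb list" where
  "T_list m = map T [1..<Suc m]"

text \<open>
  Integer polynomials in commuting variables indexed by unordered pairs of symbols, so that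
  \<open>bvar u v = bvar v u\<close> holds by construction. A monomial is its finitely supported exponent
  function. Symbols of every index are available; the polynomial ring belonging to a fixed
  \<open>m\<close> is the subring generated by the \<open>bvar u v\<close> with \<open>u, v\<close> in
  \<open>set (S_list m) \<union> set (T_list m)\<close>.
\<close>

type_synonym bpoly = "(symb uprod \<Rightarrow>\<^sub>0 nat) \<Rightarrow>\<^sub>0 int"

definition bvar :: "symb \<Rightarrow> symb \<Rightarrow> bpoly" where
  "bvar u v = Poly_Mapping.single (Poly_Mapping.single (Upair u v) 1) 1"

lemma bvar_commute: "bvar u v = bvar v u"
proof -
  have "Upair u v = Upair v u" by simp
  then show ?thesis unfolding bvar_def by metis
qed

definition Bmat :: "symb list \<Rightarrow> symb list \<Rightarrow> bpoly mat" where
  "Bmat U V = mat (length U) (length V) (\<lambda>(i, j). bvar (U ! i) (V ! j))"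

definition permanent :: "'a::comm_ring_1 mat \<Rightarrow> 'a" where
  "permanent A = (if dim_row A = dim_col A then
     (\<Sum>p\<in>{p. p permutes {0..<dim_row A}}. \<Prod>i = 0..<dim_row A. A $$ (i, p i)) else 0)"

text \<open>
  A permutation \<open>g\<close> of the symbols acts by renaming variables: the coefficient of a monomial
  \<open>M\<close> in \<open>act g p\<close> is the coefficient of \<open>M \<circ> map_uprod g\<close> in \<open>p\<close>. The
  lemmas below show that \<open>act g\<close> is the ring endomorphism sending \<open>bvar u v\<close> to
  \<open>bvar (g u) (g v)\<close>.
\<close>

definition act :: "(symb \<Rightarrow> symb) \<Rightarrow> bpoly \<Rightarrow> bpoly" where
  "act g p = Poly_Mapping.map_key (Poly_Mapping.map_key (map_uprod g)) p"

lemma inj_map_uprod: "inj g \<Longrightarrow> inj (map_uprod g)"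
  by (rule uprod.inj_map)

lemma map_key_map_uprod_inverse:
  assumes "bij g"
  shows "Poly_Mapping.map_key (map_uprod g) (Poly_Mapping.map_key (map_uprod (inv' g)) M) = M"
proof -
  have i: "inj (map_uprod g)" "inj (map_uprod (inv' g))"
    using assms by (auto intro!: inj_map_uprod simp: bij_is_inj bij_imp_bij_inv)
  have "map_uprod (inv' g) \<circ> map_uprod g = (\<lambda>x. x)"
    using assms by (simp add: fun_eq_iff uprod.map_comp bij_is_inj uprod.map_id)
  then show ?thesis
    by (simp add: Poly_Mapping.map_key_compose[OF i] Poly_Mapping.map_key_id)
qed

lemma inj_map_key_map_uprod:
  assumes "bij g"
  shows "inj (Poly_Mapping.map_key (map_uprod g) :: (symb uprod \<Rightarrow>\<^sub>0 nat) \<Rightarrow> _)"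
proof (rule inj_on_inverseI)
  fix M :: "symb uprod \<Rightarrow>\<^sub>0 nat"
  show "Poly_Mapping.map_key (map_uprod (inv' g)) (Poly_Mapping.map_key (map_uprod g) M) = M"
    using map_key_map_uprod_inverse[OF bij_imp_bij_inv[OF assms]] assms
    by (simp add: inv_inv_eq)
qed

lemma act_single:
  assumes "bij g"
  shows "act g (Poly_Mapping.single M c) =
    Poly_Mapping.single (Poly_Mapping.map_key (map_uprod (inv' g)) M) c"
  unfolding act_def
  using Poly_Mapping.map_key_single[OF inj_map_key_map_uprod[OF assms]]
    map_key_map_uprod_inverse[OF assms] by metis

lemma act_bvar:
  assumes "bij g"
  shows "act g (bvar u v) = bvar (g u) (g v)"
proof -
  have "inj (map_uprod (inv' g))"
    using assms by (auto intro!: inj_map_uprod simp: bij_is_inj bij_imp_bij_inv)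
  moreover have "Upair u v = map_uprod (inv' g) (Upair (g u) (g v))"
    using assms by (simp only: map_uprod_simps) (simp add: bij_is_inj)
  ultimately have "Poly_Mapping.map_key (map_uprod (inv' g)) (Poly_Mapping.single (Upair u v) 1)
     = Poly_Mapping.single (Upair (g u) (g v)) (1::nat)"
    by (metis Poly_Mapping.map_key_single)
  then show ?thesis
    unfolding bvar_def by (simp only: act_single[OF assms])
qed

lemma act_add: "bij g \<Longrightarrow> act g (p + q) = act g p + act g q"
  unfolding act_def by (rule Poly_Mapping.map_key_plus[OF inj_map_key_map_uprod])

lemma act_1: "bij g \<Longrightarrow> act g 1 = 1"
  using act_single[of g 0 1] inj_map_uprod[of "inv' g"]
  by (simp add: bij_is_inj bij_imp_bij_inv)

lemma act_mult:
  assumes "bij g"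
  shows "act g (p * q) = act g p * act g q"
proof -
  have i: "inj (map_uprod (inv' g))"
    using assms by (auto intro!: inj_map_uprod simp: bij_is_inj bij_imp_bij_inv)
  have s: "act g (Poly_Mapping.single M c * Poly_Mapping.single N d) =
      act g (Poly_Mapping.single M c) * act g (Poly_Mapping.single N d)" for M N c d
    by (simp add: act_single[OF assms] mult_single Poly_Mapping.map_key_plus[OF i])
  have z: "act g 0 = 0"
    unfolding act_def by (simp add: Poly_Mapping.map_key_zero[OF inj_map_key_map_uprod[OF assms]])
  have dec: "P r" if "P 0" "\<And>M c. P (Poly_Mapping.single M c)"
      "\<And>x y. P x \<Longrightarrow> P y \<Longrightarrow> P (x + y)" for P and r :: bpoly
  proof (induction r rule: Poly_Mapping.update_induct)
    case const
    show ?case by (rule that(1))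
  next
    case (update f a c)
    have "Poly_Mapping.update a c f = Poly_Mapping.single a c + f"
      using update.hyps(1)
      by (intro poly_mapping_eqI) (auto simp: lookup_add lookup_single lookup_update in_keys_iff when_def)
    then show ?case using that(2,3) update.IH by metis
  qed
  have t: "act g (Poly_Mapping.single M c * q) = act g (Poly_Mapping.single M c) * act g q" for M c
    by (rule dec[of _ q]) (auto simp: s z act_add[OF assms] distrib_left)
  show ?thesis
    by (rule dec[of _ p]) (auto simp: t z act_add[OF assms] distrib_right)
qed

definition perm_group :: "'a set \<Rightarrow> ('a \<Rightarrow> 'a) monoid" where
  "perm_group X = \<lparr>carrier = {p. p permutes X}, mult = (\<circ>), one = id\<rparr>"

definition flip :: "nat \<Rightarrow> symb \<Rightarrow> symb" where
  "flip i = transpose (S i) (T i)"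

definition G_grp :: "nat \<Rightarrow> (symb \<Rightarrow> symb) monoid" where
  "G_grp m = (let P = perm_group (set (S_list m) \<union> set (T_list m))
     in P\<lparr>carrier := generate P (flip ` {1..m})\<rparr>)"

lemma group_perm_group: "group (perm_group X)"
proof (rule groupI)
  fix p assume "p \<in> carrier (perm_group X)"
  then have "inv' p \<in> carrier (perm_group X) \<and> inv' p \<circ> p = id"
    by (auto simp: perm_group_def permutes_inv permutes_inv_o)
  then show "\<exists>q\<in>carrier (perm_group X). q \<otimes>\<^bsub>perm_group X\<^esub> p = \<one>\<^bsub>perm_group X\<^esub>"
    by (auto simp: perm_group_def)
qed (auto simp: perm_group_def permutes_compose permutes_id comp_assoc)

lemma flip_permutes: "i \<in> {1..m} \<Longrightarrow> flip i permutes set (S_list m) \<union> set (T_list m)"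
  unfolding flip_def by (rule permutes_swap_id) (auto simp: S_list_def T_list_def)

lemma group_G_grp: "group (G_grp m)"
proof -
  let ?P = "perm_group (set (S_list m) \<union> set (T_list m))"
  have "flip ` {1..m} \<subseteq> carrier ?P"
    using flip_permutes by (auto simp: perm_group_def)
  then show ?thesis
    unfolding G_grp_def Let_def
    by (intro group.subgroup_imp_group group.generate_is_subgroup group_perm_group)
qed

lemma G_grp_permutes:
  assumes "g \<in> carrier (G_grp m)"
  shows "g permutes set (S_list m) \<union> set (T_list m)"
proof -
  let ?P = "perm_group (set (S_list m) \<union> set (T_list m))"
  have "flip ` {1..m} \<subseteq> carrier ?P"
    using flip_permutes by (auto simp: perm_group_def)
  moreover have "g \<in> generate ?P (flip ` {1..m})"
    using assms by (simp add: G_grp_def Let_def)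
  ultimately have "g \<in> carrier ?P"
    by (rule group.generate_in_carrier[OF group_perm_group])
  then show ?thesis by (simp add: perm_group_def)
qed

text \<open>
  The character of \<open>G_grp m\<close> with value \<open>-1\<close> on every \<open>flip i\<close> exists: it is
  the restriction of the sign of a permutation. It is unique since the \<open>flip i\<close> generate.
\<close>

lemma sign_character:
  "sign \<in> hom (G_grp m) sign_img" "i \<in> {1..m} \<Longrightarrow> sign (flip i) = -1"
proof -
  have "permutation g" if "g \<in> carrier (G_grp m)" for g
    using G_grp_permutes[OF that] by (auto simp: permutation_permutes)
  moreover have "mult (G_grp m) = (\<circ>)"
    by (simp add: G_grp_def Let_def perm_group_def)
  ultimately show "sign \<in> hom (G_grp m) sign_img"
    by (auto simp: hom_def sign_img_def sign_compose) (auto simp: sign_def split: if_splits)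
  show "sign (flip i) = -1"
    by (simp add: flip_def sign_swap_id)
qed

definition antisym_permanent :: "nat \<Rightarrow> ((symb \<Rightarrow> symb) \<Rightarrow> int) \<Rightarrow> bpoly" where
  "antisym_permanent m \<chi> =
     (\<Sum>g\<in>carrier (G_grp m). of_int (\<chi> g) * act g (permanent (Bmat (S_list m) (T_list m))))"

definition ST_list :: "nat set \<Rightarrow> symb list" where
  "ST_list I = concat (map (\<lambda>i. [S i, T i]) (sorted_list_of_set I))"

text \<open>
  The pairs of a tuple are pairwise distinct, being made of disjoint non-empty sets, so an
  unordered \<open>k\<close>-tuple is the same thing as the set of its entries.
\<close>

definition \<D> :: "nat \<Rightarrow> nat \<Rightarrow> nat set uprod set set" where
  "\<D> m k = {(\<lambda>l. Upair (I l) (J l)) ` {1..k} | I J.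
     (\<forall>l\<in>{1..k}. I l \<noteq> {} \<and> J l \<noteq> {} \<and> card (I l) = card (J l)) \<and>
     disjoint_family_on (case_sum I J) ({1..k} <+> {1..k}) \<and>
     (\<Union>l\<in>{1..k}. I l \<union> J l) = {1..m}}"

lemma det_Bmat_commute: "det (Bmat U V) = det (Bmat V U)"
proof (cases "length U = length V")
  case True
  have "transpose_mat (Bmat U V) = Bmat V U"
    by (rule eq_matI) (auto simp: Bmat_def bvar_commute)
  moreover have "Bmat U V \<in> carrier_mat (length U) (length U)"
    using True by (simp add: Bmat_def)
  ultimately show ?thesis by (metis det_transpose)
qed (simp add: det_def Bmat_def)

lift_definition pair_det :: "nat set uprod \<Rightarrow> bpoly" is
  "\<lambda>(I, J). det (Bmat (ST_list I) (ST_list J))"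
  by (auto simp: det_Bmat_commute)

lemma pair_det_Upair: "pair_det (Upair I J) = det (Bmat (ST_list I) (ST_list J))"
  by transfer simp

end

theory Submission
  imports Defs
begin

text \<open>
  Write \<open>P M\<close> and \<open>E M\<close> for the fully antisymmetrised permanent and determinant of the
  matrix \<open>b (S i) (T j)\<close> with \<open>i, j \<in> M\<close>. The proof inverts the generating function of the
  \<open>P M\<close>, where the product of two functions of finite sets is the sum over splittings of the
  set into two parts.

  The multilinear part of MacMahon's master theorem says that, for any square matrix and any
  non-empty \<open>M\<close>, the sum over \<open>K \<subseteq> M\<close> of \<open>(-1)^|K|\<close> times the permanent on \<open>M - K\<close> times
  the determinant on \<open>K\<close> vanishes (\<open>sum_per_on_det_on\<close>). Interchanging \<open>s_i\<close> and \<open>t_i\<close>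
  affects only the factor that contains \<open>i\<close>, so the relation survives antisymmetrisation: the
  inverse of \<open>P\<close> is \<open>L \<mapsto> (-1)^|L| E L\<close> (\<open>sum_antisym_per_antisym_det\<close>).

  The heart of the matter is that \<open>E L\<close> is the sum of the determinants of the blocks with rows
  \<open>S_I \<union> T_I\<close> and columns \<open>S_J \<union> T_J\<close>, over all ordered splittings of \<open>L\<close> into \<open>I\<close> and
  \<open>J\<close> of equal size (\<open>antisym_det_eq_balanced_det\<close>). This is where the symmetry of \<open>b\<close> enters.
  Attach to every symbol \<open>u\<close> a vector \<open>(a u, d u)\<close> of the plane and consider the Pfaffian of the
  skew matrix with entries \<open>b u v (a u d v - d u a v)\<close>. If half of the symbols carry the unit
  vector \<open>e1\<close> and the others \<open>e2\<close>, it is up to sign a minor of \<open>b\<close>. Moreover it is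
  invariant under \<open>SL_2\<close> because the vectors only occur in brackets. Antisymmetrisation over the pair \<open>(s_i, t_i)\<close> inserts the symmetric tensor
  \<open>e1 \<otimes> e2 + e2 \<otimes> e1\<close> there, and the substitution \<open>e1 \<mapsto> e1 + e2\<close>,
  \<open>e2 \<mapsto> e2 - e1\<close>, of determinant 2, turns this into \<open>2 (e2 \<otimes> e2 - e1 \<otimes> e1)\<close>. Now
  both symbols of each pair carry the same unit vector; the pairs carrying \<open>e1\<close> are those indexed
  by \<open>I\<close>.

  Consequently \<open>E L\<close> vanishes for \<open>|L|\<close> odd, and for other non-empty \<open>L\<close> it is twice a sum over unordered
  pairs \<open>{I, J}\<close>. The inversion formula becomes a recursion for \<open>P\<close> that removes one pair at a
  time with weight \<open>-2\<close> (\<open>antisym_per_rec\<close>). Unfolding it gives ordered sequences of \<open>k\<close>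
  pairs, that is \<open>k!\<close> times the unordered tuples. For odd \<open>m\<close> there are no such tuples.
\<close>

section \<open>Permutations that preserve a subset\<close>

lemma restrict_id_permutes:
  assumes "r permutes X" "A \<subseteq> X" "r ` A = A"
  shows "restrict_id r A permutes A"
proof (rule bij_imp_permutes)
  have "inj_on r A"
    using assms(1) by (meson inj_on_subset permutes_inj_on subset_UNIV)
  then have "bij_betw r A A"
    using assms(3) by (simp add: bij_betw_def)
  then show "bij_betw (restrict_id r A) A A"
    by (rule bij_betw_restrict_id) auto
qed auto

lemma bij_betw_permutes_Un:
  assumes "A \<inter> B = {}"
  shows "bij_betw (\<lambda>(p, q). p \<circ> q) ({p. p permutes A} \<times> {q. q permutes B})
    {r. r permutes A \<union> B \<and> r ` A = A}"
proof (rule bij_betw_byWitness[where f' = "\<lambda>r. (restrict_id r A, restrict_id r B)"], safe)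
  fix p q assume pq: "p permutes A" "q permutes B"
  have qA: "q x = x" if "x \<in> A" for x
    using pq(2) that assms by (meson disjoint_iff permutes_not_in)
  have pB: "p (q x) = q x" if "x \<in> B" for x
    using pq that assms by (metis disjoint_iff permutes_in_image permutes_not_in)
  show "restrict_id (p \<circ> q) A = p"
    using pq(1) qA by (auto simp: restrict_id_def fun_eq_iff permutes_not_in)
  show "restrict_id (p \<circ> q) B = q"
    using pq(2) pB by (auto simp: restrict_id_def fun_eq_iff permutes_not_in)
  show "p \<circ> q permutes A \<union> B"
    using pq by (meson Un_upper1 Un_upper2 permutes_compose permutes_subset)
  show "(p \<circ> q) x \<in> A" if "x \<in> A" for x
    using pq(1) that qA by (simp add: permutes_in_image)
  show "x \<in> (p \<circ> q) ` A" if "x \<in> A" for x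
  proof -
    have "(p \<circ> q) ` A = p ` A" using qA by (auto intro!: image_cong)
    then show ?thesis using that permutes_image[OF pq(1)] by simp
  qed
next
  fix r assume r: "r permutes A \<union> B" "r ` A = A"
  have "r ` B = r ` ((A \<union> B) - A)" using assms by (auto intro!: arg_cong[where f = "(`) r"])
  also have "\<dots> = (A \<union> B) - A"
    using r permutes_inj[OF r(1)] by (simp add: image_set_diff permutes_image)
  also have "\<dots> = B" using assms by auto
  finally have rB: "r ` B = B" .
  show "restrict_id r A permutes A" "restrict_id r B permutes B"
    using restrict_id_permutes[OF r(1) _ r(2)] restrict_id_permutes[OF r(1) _ rB] by auto
  show "restrict_id r A \<circ> restrict_id r B = r"
    using rB assms permutes_not_in[OF r(1)] by (fastforce simp: fun_eq_iff restrict_id_def)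
qed

text \<open>
  A subset is invariant iff it is a union of cycles. Adding or removing a whole cycle of length
  \<open>c\<close> multiplies the summand by \<open>(-1)^c * (-1)^(c-1) = -1\<close>, so the subsets cancel in pairs.
  The induction avoids cycles: it removes a point \<open>a\<close> from its cycle, which changes
  both signs if \<open>K\<close> contains \<open>a\<close> and none otherwise. Once the point to be removed is fixed, it
  can be added to or removed from \<open>K\<close> by itself.
\<close>

lemma sum_signed_invariant_subsets:
  assumes "finite M" "M \<noteq> {}" "r permutes M"
  shows "(\<Sum>K | K \<subseteq> M \<and> r ` K = K. (-1) ^ card K * sign (restrict_id r K)) = 0"
  using assms
proof (induction M arbitrary: r rule: finite_induct)
  case empty
  then show ?case by simp
next
  case (insert a M)
  define b where "b = r a"
  define r' where "r' = transpose a b \<circ> r"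
  let ?I = "\<lambda>r M. {K. K \<subseteq> M \<and> r ` K = K}"
  let ?w = "\<lambda>r K. (-1) ^ card K * sign (restrict_id r K)"
  have r': "r' permutes M"
    unfolding r'_def b_def using insert.prems(2) by (rule permutes_insert_lemma)
  have r: "r = transpose a b \<circ> r'"
    by (simp add: r'_def fun_eq_iff)
  have r'a: "r' a = a"
    using r' insert.hyps(2) by (simp add: permutes_not_in)
  have injr: "inj r" "inj r'"
    using insert.prems(2) r' by (auto intro: permutes_inj)
  show ?case
  proof (cases "b = a")
    case True
    then have rr: "r' = r" using r by simp
    have ra: "r a = a" using rr r'a by simp
    have split: "?I r (insert a M) = ?I r M \<union> insert a ` ?I r M"
    proof (intro equalityI subsetI)
      fix K assume K: "K \<in> ?I r (insert a M)"
      show "K \<in> ?I r M \<union> insert a ` ?I r M"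
      proof (cases "a \<in> K")
        case True
        have "r ` (K - {a}) = K - {a}"
          using K injr(1) ra by (simp add: image_set_diff)
        then have "K - {a} \<in> ?I r M" "K = insert a (K - {a})"
          using K True by auto
        then show ?thesis by blast
      qed (use K in auto)
    qed (use ra in auto)
    have "?w r (insert a K) = - ?w r K" if "K \<in> ?I r M" for K
    proof -
      have "restrict_id r (insert a K) = restrict_id r K"
        using ra by (auto simp: restrict_id_def)
      moreover have "card (insert a K) = Suc (card K)"
        using that insert.hyps by (intro card_insert_disjoint) (auto intro: finite_subset)
      ultimately show ?thesis by simp
    qed
    note w = this
    have nin: "a \<notin> K" if "K \<in> ?I r M" for K using that insert.hyps(2) by blast
    have inj: "inj_on (insert a) (?I r M)"
      by (rule inj_onI) (metis nin insert_ident)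
    have "(\<Sum>K\<in>insert a ` ?I r M. ?w r K) = (\<Sum>K\<in>?I r M. - ?w r K)"
      unfolding sum.reindex[OF inj] o_def by (rule sum.cong[OF refl]) (rule w)
    moreover have "?I r M \<inter> insert a ` ?I r M = {}"
      using nin by blast
    ultimately show ?thesis
      unfolding split using insert.hyps(1)
      by (subst sum.union_disjoint) (simp_all add: sum_negf)
  next
    case False
    have "b \<in> insert a M"
      unfolding b_def using permutes_in_image[OF insert.prems(2), of a] by simp
    then have bM: "b \<in> M" using False by simp
    (* an invariant subset contains a iff it contains the successor b of a *)
    let ?up = "\<lambda>K. if b \<in> K then insert a K else K"
    have inv': "r' ` K = transpose a b ` r ` K" for K
      by (simp add: r'_def image_comp)
    have inv: "r ` K = transpose a b ` r' ` K" for K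
      by (simp add: r image_comp)
    have tr: "transpose a b ` K = K" if "a \<in> K \<longleftrightarrow> b \<in> K" for K
      using that by (rule transpose_image_eq)
    have ab: "a \<in> K \<longleftrightarrow> b \<in> K" if "r ` K = K" for K
      using that injr(1) unfolding b_def by (metis inj_image_mem_iff)
    have "(\<Sum>K\<in>?I r (insert a M). ?w r K) = (\<Sum>K\<in>?I r' M. ?w r' K)"
    proof (rule sum.reindex_bij_witness[where i = ?up and j = "\<lambda>K. K - {a}"])
      fix K assume K: "K \<in> ?I r (insert a M)"
      then have iff: "a \<in> K \<longleftrightarrow> b \<in> K" using ab by auto
      have "r' ` K = K" using K tr[OF iff] inv' by simp
      then have "r' ` (K - {a}) = K - {a}"
        using injr(2) r'a by (simp add: image_set_diff)
      then show K': "K - {a} \<in> ?I r' M" using K by auto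
      show "?up (K - {a}) = K" using iff False by auto
      have fin: "finite K" using K insert.hyps(1) finite_subset by auto
      show "?w r' (K - {a}) = ?w r K"
      proof (cases "a \<in> K")
        case True
        have "restrict_id r K = transpose a b \<circ> restrict_id r' (K - {a})"
          using True iff r'a by (auto simp: restrict_id_def fun_eq_iff r transpose_def)
        moreover have "permutation (restrict_id r' (K - {a}))"
          using restrict_id_permutes[OF r', of "K - {a}"] K' fin
          by (auto simp: permutation_permutes)
        ultimately have "sign (restrict_id r K) = - sign (restrict_id r' (K - {a}))"
          using False by (simp add: sign_compose permutation_swap_id sign_swap_id)
        moreover have "card K = Suc (card (K - {a}))"
          using True fin by (metis card_Suc_Diff1)
        ultimately show ?thesis by simp
      next
        case F: False
        have "r' x = r x" if "x \<in> K" for x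
        proof -
          have "r x \<in> K" using that K by blast
          then show ?thesis using F iff by (auto simp: r'_def transpose_def)
        qed
        then have "restrict_id r' K = restrict_id r K"
          by (auto simp: restrict_id_def)
        then show ?thesis using F by simp
      qed
    next
      fix K assume K: "K \<in> ?I r' M"
      then have "a \<notin> K" using insert.hyps(2) by auto
      then show "?up K - {a} = K" by auto
      have "r' ` ?up K = ?up K" using K r'a by auto
      then have "r ` ?up K = transpose a b ` ?up K" by (simp only: inv)
      also have "\<dots> = ?up K" by (rule tr) (use \<open>a \<notin> K\<close> in auto)
      finally show "?up K \<in> ?I r (insert a M)" using K by auto
    qed
    also have "\<dots> = 0" using insert.IH[OF _ r'] bM by auto
    finally show ?thesis .
  qed
qed

section \<open>Permanents, determinants and the multilinear master theorem\<close>

text \<open>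
  Indexing by finite sets instead of initial segments of the naturals makes principal submatrices
  available without renumbering.
\<close>

definition per_on :: "'i set \<Rightarrow> ('i \<Rightarrow> 'i \<Rightarrow> 'a::comm_ring_1) \<Rightarrow> 'a" where
  "per_on L f = (\<Sum>p | p permutes L. \<Prod>i\<in>L. f i (p i))"

definition det_on :: "'i set \<Rightarrow> ('i \<Rightarrow> 'i \<Rightarrow> 'a::comm_ring_1) \<Rightarrow> 'a" where
  "det_on L f = (\<Sum>p | p permutes L. of_int (sign p) * (\<Prod>i\<in>L. f i (p i)))"

lemma per_on_cong:
  assumes "\<And>i j. i \<in> L \<Longrightarrow> j \<in> L \<Longrightarrow> f i j = g i j"
  shows "per_on L f = per_on L g"
  unfolding per_on_def using assms by (auto intro!: sum.cong prod.cong simp: permutes_in_image)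

lemma det_on_cong:
  assumes "\<And>i j. i \<in> L \<Longrightarrow> j \<in> L \<Longrightarrow> f i j = g i j"
  shows "det_on L f = det_on L g"
  unfolding det_on_def using assms
  by (auto intro!: sum.cong prod.cong arg_cong2[where f = "(*)"] simp: permutes_in_image)

lemma per_on_empty [simp]: "per_on {} f = 1"
  by (simp add: per_on_def)

lemma det_on_empty [simp]: "det_on {} f = 1"
  by (simp add: det_on_def)

lemma bij_betw_map_permutation:
  assumes h: "bij_betw h A B"
  shows "bij_betw (map_permutation A h) {p. p permutes A} {p. p permutes B}"
proof (rule bij_betw_byWitness[where f' = "map_permutation B (inv_into A h)"])
  show "\<forall>p\<in>{p. p permutes A}. map_permutation B (inv_into A h) (map_permutation A h p) = p"
    using h by (auto intro!: map_permutation_compose_inv simp: bij_betw_inv_into_left)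
  show "\<forall>p\<in>{p. p permutes B}. map_permutation A h (map_permutation B (inv_into A h) p) = p"
    using h bij_betw_inv_into[OF h]
    by (auto intro!: map_permutation_compose_inv simp: bij_betw_inv_into_right)
qed (use h bij_betw_inv_into[OF h] in \<open>auto intro: map_permutation_permutes\<close>)

lemma det_on_reindex:
  assumes h: "bij_betw h A B" and "finite A"
  shows "det_on B f = det_on A (\<lambda>i j. f (h i) (h j))"
proof -
  have inj: "inj_on h A" and B: "B = h ` A" using h by (simp_all add: bij_betw_def)
  show ?thesis
    unfolding det_on_def
    by (subst sum.reindex_bij_betw[OF bij_betw_map_permutation[OF h], symmetric])
      (auto intro!: sum.cong simp: sign_map_permutation[OF inj _ \<open>finite A\<close>] B
        prod.reindex[OF inj] map_permutation_apply[OF inj])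
qed

text \<open>
  A permutation of \<open>M - K\<close> and one of \<open>K\<close> combine to a permutation of \<open>M\<close> that preserves
  \<open>K\<close>. After exchanging the sums, the coefficient of the monomial of a permutation is a signed
  count of its invariant subsets.
\<close>

lemma sum_per_on_det_on:
  assumes "finite M" "M \<noteq> {}"
  shows "(\<Sum>K\<in>Pow M. (-1) ^ card K * per_on (M - K) f * det_on K f) = 0"
proof -
  let ?t = "\<lambda>r. \<Prod>i\<in>M. f i (r i)"
  have K: "per_on (M - K) f * det_on K f =
      (\<Sum>r | r permutes M \<and> r ` K = K. of_int (sign (restrict_id r K)) * ?t r)"
    if "K \<subseteq> M" for K
  proof -
    have fin: "finite K" "finite (M - K)" using assms(1) that by (auto intro: finite_subset)
    have bij: "bij_betw (\<lambda>(p, q). p \<circ> q) ({p. p permutes K} \<times> {q. q permutes M - K})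
        {r. r permutes M \<and> r ` K = K}"
      using bij_betw_permutes_Un[of K "M - K"] that by (simp add: Un_absorb1)
    have "per_on (M - K) f * det_on K f = det_on K f * per_on (M - K) f"
      by (rule mult.commute)
    also have "\<dots> = (\<Sum>(p, q)\<in>{p. p permutes K} \<times> {q. q permutes M - K}.
        of_int (sign p) * ((\<Prod>i\<in>K. f i (p i)) * (\<Prod>i\<in>M-K. f i (q i))))"
      by (simp add: per_on_def det_on_def sum_product sum.cartesian_product mult.assoc)
    also have "\<dots> = (\<Sum>(p, q)\<in>{p. p permutes K} \<times> {q. q permutes M - K}.
        of_int (sign (restrict_id (p \<circ> q) K)) * ?t (p \<circ> q))"
    proof (rule sum.cong[OF refl], clarify)
      fix p q assume pq: "p permutes K" "q permutes M - K"
      have 1: "(p \<circ> q) i = p i" if "i \<in> K" for i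
        using pq(2) that by (simp add: permutes_not_in)
      have 2: "(p \<circ> q) i = q i" if "i \<in> M - K" for i
        using pq that by (metis DiffD2 comp_apply permutes_in_image permutes_not_in)
      have "?t (p \<circ> q) = (\<Prod>i\<in>M-K. f i ((p \<circ> q) i)) * (\<Prod>i\<in>K. f i ((p \<circ> q) i))"
        using assms(1) that by (simp add: prod.subset_diff)
      also have "\<dots> = (\<Prod>i\<in>K. f i (p i)) * (\<Prod>i\<in>M-K. f i (q i))"
        using 1 2 by (simp add: mult.commute)
      finally have "?t (p \<circ> q) = \<dots>" .
      moreover have "restrict_id (p \<circ> q) K = p"
        using 1 pq(1) by (auto simp: restrict_id_def fun_eq_iff permutes_not_in)
      ultimately show "of_int (sign p) * ((\<Prod>i\<in>K. f i (p i)) * (\<Prod>i\<in>M-K. f i (q i)))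
        = of_int (sign (restrict_id (p \<circ> q) K)) * ?t (p \<circ> q)" by simp
    qed
    also have "\<dots> = (\<Sum>r | r permutes M \<and> r ` K = K. of_int (sign (restrict_id r K)) * ?t r)"
      by (subst sum.reindex_bij_betw[OF bij, symmetric]) (simp add: case_prod_unfold)
    finally show ?thesis .
  qed
  have "(\<Sum>K\<in>Pow M. (-1) ^ card K * per_on (M - K) f * det_on K f) =
      (\<Sum>K\<in>Pow M. \<Sum>r | r permutes M \<and> r ` K = K.
        of_int ((-1) ^ card K * sign (restrict_id r K)) * ?t r)"
    by (rule sum.cong) (simp_all add: K mult.assoc sum_distrib_left)
  also have "\<dots> = (\<Sum>r | r permutes M. \<Sum>K\<in>{K\<in>Pow M. r ` K = K}.
        of_int ((-1) ^ card K * sign (restrict_id r K)) * ?t r)"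
    using sum.swap_restrict[of "Pow M" "{r. r permutes M}" 
       "\<lambda>K r. of_int ((-1) ^ card K * sign (restrict_id r K)) * ?t r" "\<lambda>K r. r ` K = K"] assms(1)
    by (simp add: finite_permutations)
  also have "\<dots> = (\<Sum>r | r permutes M.
      of_int (\<Sum>K | K \<subseteq> M \<and> r ` K = K. (-1) ^ card K * sign (restrict_id r K)) * ?t r)"
    by (simp add: sum_distrib_right Pow_def)
  also have "\<dots> = 0"
    using sum_signed_invariant_subsets[OF assms] by (intro sum.neutral) auto
  finally show ?thesis .
qed

section \<open>Antisymmetrisation\<close>

definition symbols :: "nat set \<Rightarrow> symb set" where
  "symbols L = S ` L \<union> T ` L"

text \<open>
  The sets \<open>A\<close> of interchanged indices parametrise the group generated by the flips.
\<close>

definition swap_on :: "nat set \<Rightarrow> symb \<Rightarrow> symb" where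
  "swap_on A x = (case x of S i \<Rightarrow> if i \<in> A then T i else S i | T i \<Rightarrow> if i \<in> A then S i else T i)"

lemma swap_on_simps [simp]:
  "swap_on A (S i) = (if i \<in> A then T i else S i)"
  "swap_on A (T i) = (if i \<in> A then S i else T i)"
  by (simp_all add: swap_on_def)

lemma swap_on_empty [simp]: "swap_on {} = id"
  by (auto simp: swap_on_def fun_eq_iff split: symb.split)

lemma swap_on_insert:
  assumes "i \<notin> A"
  shows "swap_on (insert i A) = flip i \<circ> swap_on A"
proof
  fix x show "swap_on (insert i A) x = (flip i \<circ> swap_on A) x"
    using assms by (cases x) (auto simp: flip_def transpose_def)
qed

lemma finite_symbols [simp]: "finite L \<Longrightarrow> finite (symbols L)"
  by (simp add: symbols_def)

lemma symbols_simps [simp]: "S i \<in> symbols L \<longleftrightarrow> i \<in> L" "T i \<in> symbols L \<longleftrightarrow> i \<in> L"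
  by (auto simp: symbols_def)

lemma swap_on_permutes:
  assumes "A \<subseteq> L"
  shows "swap_on A permutes symbols L"
proof (rule bij_imp_permutes)
  have "swap_on A (swap_on A x) = x" for x by (cases x) auto
  then show "bij_betw (swap_on A) (symbols L) (symbols L)"
    by (intro bij_betw_byWitness[where f' = "swap_on A"]) (use assms in \<open>auto simp: symbols_def\<close>)
  show "swap_on A x = x" if "x \<notin> symbols L" for x
    using that assms by (cases x) auto
qed

lemma sign_swap_on:
  assumes "finite A"
  shows "sign (swap_on A) = (-1) ^ card A"
  using assms
proof (induction A rule: finite_induct)
  case (insert i A)
  have "permutation (swap_on A)"
    using swap_on_permutes[of A A] insert.hyps(1) by (metis permutation_permutes finite_symbols order_refl)
  then have "sign (swap_on (insert i A)) = sign (flip i) * sign (swap_on A)"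
    unfolding swap_on_insert[OF insert.hyps(2)]
    by (intro sign_compose) (simp_all add: flip_def permutation_swap_id)
  then show ?case using insert by (simp add: flip_def sign_swap_id)
qed (simp add: sign_id)

definition antisym_per :: "(symb \<Rightarrow> symb \<Rightarrow> 'a::comm_ring_1) \<Rightarrow> nat set \<Rightarrow> 'a" where
  "antisym_per b M =
    (\<Sum>A\<in>Pow M. (-1) ^ card A * per_on M (\<lambda>i j. b (swap_on A (S i)) (swap_on A (T j))))"

definition antisym_det :: "(symb \<Rightarrow> symb \<Rightarrow> 'a::comm_ring_1) \<Rightarrow> nat set \<Rightarrow> 'a" where
  "antisym_det b M =
    (\<Sum>A\<in>Pow M. (-1) ^ card A * det_on M (\<lambda>i j. b (swap_on A (S i)) (swap_on A (T j))))"

text \<open>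
  The submatrix on \<open>M - K\<close> only sees the part of \<open>A\<close> outside \<open>K\<close>, and the one on \<open>K\<close>
  only the part inside, so antisymmetrising the factors separately is the same as antisymmetrising
  their product.
\<close>

lemma antisym_per_mult_antisym_det:
  assumes "finite M" "K \<subseteq> M"
  shows "antisym_per b (M - K) * antisym_det b K = (\<Sum>A\<in>Pow M. (-1) ^ card A *
    (per_on (M - K) (\<lambda>i j. b (swap_on A (S i)) (swap_on A (T j))) *
     det_on K (\<lambda>i j. b (swap_on A (S i)) (swap_on A (T j)))))"
proof -
  let ?e = "\<lambda>A i j. b (swap_on A (S i)) (swap_on A (T j))"
  have fin: "finite K" using assms finite_subset by blast
  have "antisym_per b (M - K) * antisym_det b K =
    (\<Sum>(A, C)\<in>Pow (M - K) \<times> Pow K. ((-1) ^ card A * per_on (M - K) (?e A)) *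
       ((-1) ^ card C * det_on K (?e C)))"
    by (simp add: antisym_per_def antisym_det_def sum_product sum.cartesian_product)
  also have "\<dots> = (\<Sum>A\<in>Pow M. (-1) ^ card A * (per_on (M - K) (?e A) * det_on K (?e A)))"
  proof (rule sum.reindex_bij_witness[where i = "\<lambda>A. (A - K, A \<inter> K)" and j = "\<lambda>(A, C). A \<union> C"], safe)
    fix A C assume AC: "A \<subseteq> M - K" "C \<subseteq> K"
    have "per_on (M - K) (?e (A \<union> C)) = per_on (M - K) (?e A)"
      using AC by (intro per_on_cong) auto
    moreover have "det_on K (?e (A \<union> C)) = det_on K (?e C)"
      using AC by (intro det_on_cong) auto
    moreover have "card (A \<union> C) = card A + card C"
      using AC assms fin by (intro card_Un_disjoint) (auto intro: finite_subset)
    ultimately show "(-1) ^ card (A \<union> C) * (per_on (M - K) (?e (A \<union> C)) * det_on K (?e (A \<union> C)))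
        = ((-1) ^ card A * per_on (M - K) (?e A)) * ((-1) ^ card C * det_on K (?e C))"
      by (simp add: power_add)
  qed (use assms in auto)
  finally show ?thesis .
qed

lemma sum_antisym_per_antisym_det:
  assumes "finite M" "M \<noteq> {}"
  shows "(\<Sum>K\<in>Pow M. (-1) ^ card K * (antisym_per b (M - K) * antisym_det b K)) = 0"
proof -
  let ?e = "\<lambda>A i j. b (swap_on A (S i)) (swap_on A (T j))"
  have "(\<Sum>K\<in>Pow M. (-1) ^ card K * (antisym_per b (M - K) * antisym_det b K)) =
    (\<Sum>K\<in>Pow M. \<Sum>A\<in>Pow M. (-1) ^ card A *
       ((-1) ^ card K * per_on (M - K) (?e A) * det_on K (?e A)))"
    by (intro sum.cong refl, subst antisym_per_mult_antisym_det[OF assms(1)])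
      (simp_all add: sum_distrib_left mult_ac)
  also have "\<dots> = (\<Sum>A\<in>Pow M. (-1) ^ card A *
       (\<Sum>K\<in>Pow M. (-1) ^ card K * per_on (M - K) (?e A) * det_on K (?e A)))"
    unfolding sum_distrib_left by (rule sum.swap)
  also have "\<dots> = 0" by (simp add: sum_per_on_det_on[OF assms])
  finally show ?thesis .
qed

section \<open>Invariance of the Pfaffian under a change of basis\<close>

text \<open>
  The pair \<open>(a u, d u)\<close> is the plane vector attached to the symbol \<open>u\<close>. The sum is
  \<open>|L|!\<close> times the Pfaffian: the order of the pairs accounts for the factorial, and the two orders
  within a pair supply the two terms of the bracket \<open>a u d v - d u a v\<close>.
\<close>

definition pairing_sum ::
    "(symb \<Rightarrow> symb \<Rightarrow> 'a::comm_ring_1) \<Rightarrow> nat set \<Rightarrow> (symb \<Rightarrow> 'a) \<Rightarrow> (symb \<Rightarrow> 'a) \<Rightarrow> 'a" where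
  "pairing_sum b L a d = (\<Sum>\<pi> | \<pi> permutes symbols L. of_int (sign \<pi>) *
     (\<Prod>i\<in>L. b (\<pi> (S i)) (\<pi> (T i)) * (a (\<pi> (S i)) * d (\<pi> (T i)))))"

text \<open>
  Exchanging \<open>\<pi> (S i)\<close> and \<open>\<pi> (T i)\<close> changes the sign of \<open>\<pi>\<close> and leaves the symmetric
  factor \<open>b\<close> alone. Hence the \<open>2 ^ card L\<close> terms of the expanded product of brackets all have
  the same sum.
\<close>

lemma pairing_sum_bracket:
  assumes "finite L" and sym: "\<And>u v. b u v = b v u"
  shows "2 ^ card L * pairing_sum b L a d = (\<Sum>\<pi> | \<pi> permutes symbols L. of_int (sign \<pi>) *
     (\<Prod>i\<in>L. b (\<pi> (S i)) (\<pi> (T i)) *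
        (a (\<pi> (S i)) * d (\<pi> (T i)) - d (\<pi> (S i)) * a (\<pi> (T i)))))"
proof -
  let ?P = "{\<pi>. \<pi> permutes symbols L}"
  let ?t = "\<lambda>\<pi>. \<Prod>i\<in>L. b (\<pi> (S i)) (\<pi> (T i)) * (a (\<pi> (S i)) * d (\<pi> (T i)))"
  have expand: "(\<Prod>i\<in>L. b (\<pi> (S i)) (\<pi> (T i)) *
        (a (\<pi> (S i)) * d (\<pi> (T i)) - d (\<pi> (S i)) * a (\<pi> (T i)))) =
      (\<Sum>A\<in>Pow L. (-1) ^ card A * ?t (\<pi> \<circ> swap_on A))" for \<pi>
  proof -
    let ?g = "\<lambda>i. b (\<pi> (S i)) (\<pi> (T i)) * (a (\<pi> (S i)) * d (\<pi> (T i)))"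
    let ?h = "\<lambda>i. b (\<pi> (S i)) (\<pi> (T i)) * (d (\<pi> (S i)) * a (\<pi> (T i)))"
    have "(\<Prod>i\<in>L. b (\<pi> (S i)) (\<pi> (T i)) *
        (a (\<pi> (S i)) * d (\<pi> (T i)) - d (\<pi> (S i)) * a (\<pi> (T i)))) = (\<Prod>i\<in>L. - ?h i + ?g i)"
      by (simp add: algebra_simps)
    also have "\<dots> = (\<Sum>A\<in>Pow L. (\<Prod>i\<in>A. - ?h i) * (\<Prod>i\<in>L-A. ?g i))"
      by (rule prod_add[OF assms(1)])
    also have "\<dots> = (\<Sum>A\<in>Pow L. (-1) ^ card A * ?t (\<pi> \<circ> swap_on A))"
    proof (rule sum.cong[OF refl])
      fix A assume "A \<in> Pow L"
      then have "?t (\<pi> \<circ> swap_on A) =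
          (\<Prod>i\<in>L-A. b ((\<pi> \<circ> swap_on A) (S i)) ((\<pi> \<circ> swap_on A) (T i)) *
             (a ((\<pi> \<circ> swap_on A) (S i)) * d ((\<pi> \<circ> swap_on A) (T i)))) *
          (\<Prod>i\<in>A. b ((\<pi> \<circ> swap_on A) (S i)) ((\<pi> \<circ> swap_on A) (T i)) *
             (a ((\<pi> \<circ> swap_on A) (S i)) * d ((\<pi> \<circ> swap_on A) (T i))))"
        using assms(1) by (intro prod.subset_diff) auto
      also have "\<dots> = (\<Prod>i\<in>L-A. ?g i) * (\<Prod>i\<in>A. ?h i)"
      proof (rule arg_cong2[where f = "(*)"])
        have "b (\<pi> (T i)) (\<pi> (S i)) * (a (\<pi> (T i)) * d (\<pi> (S i))) = ?h i" for i
          by (simp add: sym[of "\<pi> (T i)"] mult.commute)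
        then show "(\<Prod>i\<in>A. b ((\<pi> \<circ> swap_on A) (S i)) ((\<pi> \<circ> swap_on A) (T i)) *
             (a ((\<pi> \<circ> swap_on A) (S i)) * d ((\<pi> \<circ> swap_on A) (T i)))) = prod ?h A"
          by (intro prod.cong) simp_all
      qed (auto intro: prod.cong)
      finally show "(\<Prod>i\<in>A. - ?h i) * (\<Prod>i\<in>L-A. ?g i) = (-1) ^ card A * ?t (\<pi> \<circ> swap_on A)"
        by (simp add: prod_uminus mult_ac)
    qed
    finally show ?thesis .
  qed
  have shift: "(\<Sum>\<pi>\<in>?P. of_int (sign \<pi>) * ((-1) ^ card A * ?t (\<pi> \<circ> swap_on A))) =
      pairing_sum b L a d" if A: "A \<in> Pow L" for A
  proof -
    have fin: "finite A" using A assms(1) finite_subset by blast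
    have *: "swap_on A permutes symbols L" using A by (intro swap_on_permutes) auto
    have "permutation \<pi>" if "\<pi> \<in> ?P" for \<pi>
      using that assms(1) by (auto simp: permutation_permutes intro: finite_symbols)
    moreover have "swap_on A \<in> ?P" using * by simp
    ultimately have "sign (\<pi> \<circ> swap_on A) = sign \<pi> * (-1) ^ card A" if "\<pi> \<in> ?P" for \<pi>
      using that by (simp only: sign_compose sign_swap_on[OF fin])
    then have "(\<Sum>\<pi>\<in>?P. of_int (sign \<pi>) * ((-1) ^ card A * ?t (\<pi> \<circ> swap_on A))) =
        (\<Sum>\<pi>\<in>?P. of_int (sign (\<pi> \<circ> swap_on A)) * ?t (\<pi> \<circ> swap_on A))"
      by (intro sum.cong) (auto simp: mult.assoc)
    also have "\<dots> = (\<Sum>\<pi>\<in>?P. of_int (sign \<pi>) * ?t \<pi>)"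
      by (rule sum_permutations_compose_right[OF *, symmetric])
    finally show ?thesis by (simp add: pairing_sum_def)
  qed
  have "(\<Sum>\<pi>\<in>?P. of_int (sign \<pi>) * (\<Prod>i\<in>L. b (\<pi> (S i)) (\<pi> (T i)) *
        (a (\<pi> (S i)) * d (\<pi> (T i)) - d (\<pi> (S i)) * a (\<pi> (T i))))) =
      (\<Sum>\<pi>\<in>?P. \<Sum>A\<in>Pow L. of_int (sign \<pi>) * ((-1) ^ card A * ?t (\<pi> \<circ> swap_on A)))"
    by (simp only: expand sum_distrib_left)
  also have "\<dots> = (\<Sum>A\<in>Pow L. \<Sum>\<pi>\<in>?P. of_int (sign \<pi>) * ((-1) ^ card A * ?t (\<pi> \<circ> swap_on A)))"
    by (rule sum.swap)
  also have "\<dots> = (\<Sum>A\<in>Pow L. pairing_sum b L a d)"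
    by (rule sum.cong[OF refl]) (rule shift)
  also have "\<dots> = 2 ^ card L * pairing_sum b L a d"
    using assms(1) by (simp add: card_Pow)
  finally show ?thesis by simp
qed

text \<open>
  The matrix of the substitution has determinant 2, so it doubles every bracket. Since no division
  is available in the ring of coefficients, powers of 2 remain on both sides.
\<close>

lemma pairing_sum_rotate:
  assumes "finite L" and sym: "\<And>u v. b u v = b v u"
  shows "2 ^ card L * pairing_sum b L (\<lambda>x. a x - d x) (\<lambda>x. a x + d x) =
    4 ^ card L * pairing_sum b L a d"
proof -
  have bracket: "(a u - d u) * (a v + d v) - (a u + d u) * (a v - d v) = 2 * (a u * d v - d u * a v)"
    for u v by (simp add: algebra_simps)
  have "2 ^ card L * pairing_sum b L (\<lambda>x. a x - d x) (\<lambda>x. a x + d x) =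
     (\<Sum>\<pi> | \<pi> permutes symbols L. of_int (sign \<pi>) * (\<Prod>i\<in>L. 2 * (b (\<pi> (S i)) (\<pi> (T i)) *
        (a (\<pi> (S i)) * d (\<pi> (T i)) - d (\<pi> (S i)) * a (\<pi> (T i))))))"
    by (simp only: pairing_sum_bracket[OF assms] bracket mult.left_commute[of 2])
  also have "\<dots> = 2 ^ card L * (\<Sum>\<pi> | \<pi> permutes symbols L. of_int (sign \<pi>) * (\<Prod>i\<in>L. b (\<pi> (S i)) (\<pi> (T i)) *
        (a (\<pi> (S i)) * d (\<pi> (T i)) - d (\<pi> (S i)) * a (\<pi> (T i)))))"
    unfolding prod.distrib[of "\<lambda>_. 2"] by (simp add: sum_distrib_left mult.left_commute)
  also have "\<dots> = 2 ^ card L * (2 ^ card L * pairing_sum b L a d)"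
    by (simp only: pairing_sum_bracket[OF assms])
  finally show ?thesis
    by (simp flip: mult.assoc power_mult_distrib)
qed

text \<open>
  The value of \<open>pairing_sum\<close> when the symbols of \<open>Y\<close> carry the first unit vector and the
  other symbols the second one, as \<open>pairing_sum_indicator\<close> shows.
\<close>

definition half_sum :: "(symb \<Rightarrow> symb \<Rightarrow> 'a::comm_ring_1) \<Rightarrow> nat set \<Rightarrow> symb set \<Rightarrow> 'a" where
  "half_sum b L Y = (\<Sum>\<pi> | \<pi> permutes symbols L \<and> \<pi> ` S ` L = Y.
     of_int (sign \<pi>) * (\<Prod>i\<in>L. b (\<pi> (S i)) (\<pi> (T i))))"

lemma pairing_sum_indicator:
  assumes "finite L" "Y \<subseteq> symbols L"
  shows "pairing_sum b L (\<lambda>x. of_bool (x \<in> Y)) (\<lambda>x. of_bool (x \<notin> Y)) = half_sum b L Y"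
proof -
  have *: "(\<forall>i\<in>L. \<pi> (S i) \<in> Y \<and> \<pi> (T i) \<notin> Y) \<longleftrightarrow> \<pi> ` S ` L = Y"
    if \<pi>: "\<pi> permutes symbols L" for \<pi>
  proof
    assume h: "\<forall>i\<in>L. \<pi> (S i) \<in> Y \<and> \<pi> (T i) \<notin> Y"
    have "y \<in> \<pi> ` S ` L" if "y \<in> Y" for y
    proof -
      have "y \<in> \<pi> ` symbols L" using that assms(2) permutes_image[OF \<pi>] by auto
      then show ?thesis using h that by (auto simp: symbols_def)
    qed
    then show "\<pi> ` S ` L = Y" using h by auto
  next
    assume h: "\<pi> ` S ` L = Y"
    have "\<pi> (T i) \<notin> \<pi> ` S ` L" for i
      using permutes_inj[OF \<pi>] by (auto dest: injD)
    then show "\<forall>i\<in>L. \<pi> (S i) \<in> Y \<and> \<pi> (T i) \<notin> Y" using h by auto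
  qed
  have "(\<Prod>i\<in>L. b (\<pi> (S i)) (\<pi> (T i)) * (of_bool (\<pi> (S i) \<in> Y) * of_bool (\<pi> (T i) \<notin> Y))) =
      (if \<pi> ` S ` L = Y then (\<Prod>i\<in>L. b (\<pi> (S i)) (\<pi> (T i))) else 0)"
    if \<pi>: "\<pi> permutes symbols L" for \<pi>
  proof (cases "\<pi> ` S ` L = Y")
    case True
    then show ?thesis using *[OF \<pi>] by (auto intro!: prod.cong)
  next
    case False
    then obtain i where "i \<in> L" "\<not> (\<pi> (S i) \<in> Y \<and> \<pi> (T i) \<notin> Y)" using *[OF \<pi>] by blast
    then have "(\<Prod>i\<in>L. b (\<pi> (S i)) (\<pi> (T i)) * (of_bool (\<pi> (S i) \<in> Y) * of_bool (\<pi> (T i) \<notin> Y))) = 0"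
      using assms by (intro prod_zero) auto
    then show ?thesis using False by simp
  qed
  then show ?thesis
    unfolding pairing_sum_def half_sum_def using assms(1)
    by (intro sum.mono_neutral_cong_right) (auto simp: finite_permutations)
qed

lemma half_sum_eq_0:
  assumes "finite L" "card Y \<noteq> card L"
  shows "half_sum b L Y = 0"
proof -
  have "card (\<pi> ` S ` L) = card L" if "\<pi> permutes symbols L" for \<pi>
    using permutes_inj_on[OF that] by (subst image_image, subst card_image) (auto simp: inj_on_def)
  then have "{\<pi>. \<pi> permutes symbols L \<and> \<pi> ` S ` L = Y} = {}" using assms(2) by auto
  then show ?thesis unfolding half_sum_def by (metis (lifting) sum.empty)
qed

text \<open>
  The indicator of a transversal and that of its complement have difference \<open>\<plusminus>1\<close>. The sign
  at \<open>S i\<close> is opposite to the sign at \<open>T i\<close>. Summing over both choices at \<open>i\<close> gives 0 unless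
  \<open>Y\<close> contains both or neither of \<open>S i\<close> and \<open>T i\<close>.
\<close>

lemma sum_transversal_signs:
  assumes "finite L" "Y \<subseteq> symbols L"
  shows "(\<Sum>A\<in>Pow L. \<Prod>y\<in>Y. if y \<in> swap_on A ` S ` L then 1 else - 1 :: 'a::comm_ring_1) =
    (\<Sum>I\<in>Pow L. if Y = symbols I then 2 ^ card L * (-1) ^ card I else 0)"
proof -
  (* factor contributed by the index i when i lies in A (s) and when it does not (t) *)
  define s where "s i = (if S i \<in> Y then -1 else 1 :: 'a)" for i
  define t where "t i = (if T i \<in> Y then -1 else 1 :: 'a)" for i
  have Y: "Y = S ` {i \<in> L. S i \<in> Y} \<union> T ` {i \<in> L. T i \<in> Y}"
  proof
    show "Y \<subseteq> S ` {i \<in> L. S i \<in> Y} \<union> T ` {i \<in> L. T i \<in> Y}"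
      using assms(2) unfolding symbols_def by blast
  qed auto
  have product: "(\<Prod>y\<in>Y. if y \<in> swap_on A ` S ` L then 1 else - 1 :: 'a) = (\<Prod>i\<in>A. s i) * (\<Prod>i\<in>L-A. t i)"
    if A: "A \<in> Pow L" for A
  proof -
    let ?f = "\<lambda>y. if y \<in> swap_on A ` S ` L then 1 else - 1 :: 'a"
    have fS: "?f (S i) = (if i \<in> A then -1 else 1)" if "i \<in> L" for i
      using that by (auto simp: image_iff split: if_splits)
    have fT: "?f (T i) = (if i \<in> A then 1 else -1)" if "i \<in> L" for i
      using that A by (auto simp: image_iff split: if_splits)
    have "prod ?f Y = prod ?f (S ` {i \<in> L. S i \<in> Y}) * prod ?f (T ` {i \<in> L. T i \<in> Y})"
      using assms(1) by (subst Y, intro prod.union_disjoint) auto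
    also have "prod ?f (S ` {i \<in> L. S i \<in> Y}) = (\<Prod>i | i \<in> L \<and> S i \<in> Y. if i \<in> A then -1 else 1)"
      by (subst prod.reindex) (auto simp: inj_on_def fS simp del: image_iff intro!: prod.cong)
    also have "\<dots> = (\<Prod>i\<in>A. s i)"
      using A assms(1) unfolding s_def
      by (subst (1 2) prod.If_cases) (auto intro: finite_subset intro!: arg_cong2[where f = power] arg_cong[where f = card])
    also have "prod ?f (T ` {i \<in> L. T i \<in> Y}) = (\<Prod>i | i \<in> L \<and> T i \<in> Y. if i \<in> A then 1 else -1)"
      by (subst prod.reindex) (auto simp: inj_on_def fT simp del: image_iff intro!: prod.cong)
    also have "\<dots> = (\<Prod>i\<in>L-A. t i)"
      using A assms(1) unfolding t_def
      by (subst (1 2) prod.If_cases) (auto intro: finite_subset intro!: arg_cong2[where f = power] arg_cong[where f = card])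
    finally show ?thesis .
  qed
  have "(\<Sum>A\<in>Pow L. \<Prod>y\<in>Y. if y \<in> swap_on A ` S ` L then 1 else - 1 :: 'a) = (\<Prod>i\<in>L. s i + t i)"
    by (simp add: product prod_add[OF assms(1)])
  also have "\<dots> = (\<Sum>I\<in>Pow L. if Y = symbols I then 2 ^ card L * (-1) ^ card I else 0)"
  proof (cases "\<exists>I\<in>Pow L. Y = symbols I")
    case True
    then obtain I where I: "I \<subseteq> L" "Y = symbols I" by blast
    have inj: "symbols I = symbols I' \<longleftrightarrow> I' = I" for I'
      by (auto simp: symbols_def)
    have "s i + t i = 2 * (if i \<in> I then -1 else 1)" for i
      using I(2) by (simp add: s_def t_def)
    then have "(\<Prod>i\<in>L. s i + t i) = 2 ^ card L * (\<Prod>i\<in>L. if i \<in> I then -1 else 1)"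
      by (simp add: prod.distrib)
    also have "(\<Prod>i\<in>L. if i \<in> I then -1 else 1 :: 'a) = (-1) ^ card I"
      using assms(1) I(1) by (simp add: prod.If_cases Int_absorb1)
    finally show ?thesis using I assms(1) by (simp add: inj)
  next
    case False
    have "\<exists>i\<in>L. (S i \<in> Y) \<noteq> (T i \<in> Y)"
    proof (rule ccontr)
      assume "\<not> ?thesis"
      then have "Y = symbols {i \<in> L. S i \<in> Y}"
        by (subst Y) (auto simp: symbols_def)
      then show False using False by auto
    qed
    then obtain i where i: "i \<in> L" "(S i \<in> Y) \<noteq> (T i \<in> Y)" by blast
    then have "s i + t i = 0" by (auto simp: s_def t_def)
    then have "(\<Prod>i\<in>L. s i + t i) = 0" using i(1) assms(1) by (intro prod_zero) auto
    then show ?thesis using False by (auto intro!: sum.neutral[symmetric])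
  qed
  finally show ?thesis .
qed

text \<open>
  The tensor \<open>e1 \<otimes> e2 + e2 \<otimes> e1\<close> at every pair on the left, and
  \<open>e2 \<otimes> e2 - e1 \<otimes> e1\<close> on the right, are related by the substitution of
  \<open>pairing_sum_rotate\<close> up to scalars.
\<close>

lemma sum_half_sum_transversal:
  fixes b :: "symb \<Rightarrow> symb \<Rightarrow> 'a::comm_ring_1"
  assumes "finite L" and sym: "\<And>u v. b u v = b v u"
  shows "4 ^ card L * (\<Sum>A\<in>Pow L. half_sum b L (swap_on A ` S ` L)) =
    4 ^ card L * (\<Sum>I\<in>Pow L. (-1) ^ card I * half_sum b L (symbols I))"
proof -
  let ?P = "{\<pi>. \<pi> permutes symbols L}"
  let ?Y = "\<lambda>A. swap_on A ` S ` L"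
  let ?h = "\<lambda>A y. if y \<in> ?Y A then 1 else - 1 :: 'a"
  let ?t = "\<lambda>\<pi>. of_int (sign \<pi>) * (\<Prod>i\<in>L. b (\<pi> (S i)) (\<pi> (T i)))"
  have fP: "finite ?P" using assms(1) by (simp add: finite_permutations)
  have "4 ^ card L * half_sum b L (?Y A) = 2 ^ card L * (\<Sum>\<pi>\<in>?P. ?t \<pi> * (\<Prod>y\<in>\<pi> ` S ` L. ?h A y))"
    if A: "A \<in> Pow L" for A
  proof -
    have sub: "?Y A \<subseteq> symbols L" by (auto simp: symbols_def)
    have "(\<lambda>x. of_bool (x \<in> ?Y A) - of_bool (x \<notin> ?Y A)) = ?h A" by (auto simp: fun_eq_iff)
    moreover have "(\<lambda>x. of_bool (x \<in> ?Y A) + of_bool (x \<notin> ?Y A)) = (\<lambda>x. 1 :: 'a)"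
      by (auto simp: fun_eq_iff)
    ultimately have "4 ^ card L * half_sum b L (?Y A) = 2 ^ card L * pairing_sum b L (?h A) (\<lambda>_. 1)"
      using pairing_sum_rotate[OF assms, where a = "\<lambda>x. of_bool (x \<in> ?Y A)" and d = "\<lambda>x. of_bool (x \<notin> ?Y A)"]
        pairing_sum_indicator[OF assms(1) sub, of b] by simp
    also have "pairing_sum b L (?h A) (\<lambda>_. 1) = (\<Sum>\<pi>\<in>?P. ?t \<pi> * (\<Prod>y\<in>\<pi> ` S ` L. ?h A y))"
      unfolding pairing_sum_def
    proof (rule sum.cong[OF refl])
      fix \<pi> assume "\<pi> \<in> ?P"
      then have "inj_on (\<lambda>i. \<pi> (S i)) L" by (auto simp: inj_on_def dest!: permutes_inj injD)
      then have "(\<Prod>y\<in>\<pi> ` S ` L. ?h A y) = (\<Prod>i\<in>L. ?h A (\<pi> (S i)))"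
        unfolding image_image by (simp only: prod.reindex o_def)
      then show "of_int (sign \<pi>) * (\<Prod>i\<in>L. b (\<pi> (S i)) (\<pi> (T i)) * (?h A (\<pi> (S i)) * 1)) =
          ?t \<pi> * (\<Prod>y\<in>\<pi> ` S ` L. ?h A y)"
        by (simp only: prod.distrib mult_1_right mult.assoc)
    qed
    finally show ?thesis .
  qed
  then have "4 ^ card L * (\<Sum>A\<in>Pow L. half_sum b L (?Y A)) =
      2 ^ card L * (\<Sum>A\<in>Pow L. \<Sum>\<pi>\<in>?P. ?t \<pi> * (\<Prod>y\<in>\<pi> ` S ` L. ?h A y))"
    by (simp add: sum_distrib_left)
  also have "(\<Sum>A\<in>Pow L. \<Sum>\<pi>\<in>?P. ?t \<pi> * (\<Prod>y\<in>\<pi> ` S ` L. ?h A y)) =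
      (\<Sum>\<pi>\<in>?P. ?t \<pi> * (\<Sum>A\<in>Pow L. \<Prod>y\<in>\<pi> ` S ` L. ?h A y))"
    unfolding sum_distrib_left by (rule sum.swap)
  also have "\<dots> = (\<Sum>\<pi>\<in>?P. ?t \<pi> *
      (\<Sum>I\<in>Pow L. if \<pi> ` S ` L = symbols I then 2 ^ card L * (-1) ^ card I else 0))"
  proof (rule sum.cong[OF refl])
    fix \<pi> assume "\<pi> \<in> ?P"
    then have "\<pi> ` S ` L \<subseteq> symbols L"
      by (auto simp: permutes_in_image)
    then show "?t \<pi> * (\<Sum>A\<in>Pow L. \<Prod>y\<in>\<pi> ` S ` L. ?h A y) = ?t \<pi> *
      (\<Sum>I\<in>Pow L. if \<pi> ` S ` L = symbols I then 2 ^ card L * (-1) ^ card I else 0)"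
      by (simp only: sum_transversal_signs[OF assms(1)])
  qed
  also have "\<dots> = (\<Sum>I\<in>Pow L. \<Sum>\<pi>\<in>?P. if \<pi> ` S ` L = symbols I
        then 2 ^ card L * ((-1) ^ card I * ?t \<pi>) else 0)"
    unfolding sum_distrib_left by (subst sum.swap, intro sum.cong refl) (auto simp: mult_ac)
  also have "\<dots> = (\<Sum>I\<in>Pow L. 2 ^ card L * ((-1) ^ card I * half_sum b L (symbols I)))"
    unfolding half_sum_def sum_distrib_left
    by (rule sum.cong[OF refl], rule sum.mono_neutral_cong_right) (use fP in auto)
  finally show ?thesis
    by (simp add: sum_distrib_left flip: mult.assoc power_mult_distrib)
qed

section \<open>The antisymmetrised determinant as a sum of block determinants\<close>

text \<open>
  The permutations with the prescribed image of \<open>S ` L\<close> form a coset \<open>\<pi> \<circ> (\<sigma> \<times> \<tau>)\<close>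
  with \<open>\<sigma>\<close> and \<open>\<tau>\<close> permuting the rows and the columns. Their product depends on
  \<open>\<tau> \<circ> inverse \<sigma>\<close> only, whence the factorial.
\<close>

lemma half_sum_image:
  assumes L: "finite L" and \<pi>: "\<pi> permutes symbols L"
  shows "half_sum b L (\<pi> ` S ` L) =
    of_int (sign \<pi>) * (of_nat (fact (card L)) * det_on L (\<lambda>i j. b (\<pi> (S i)) (\<pi> (T j))))"
proof -
  let ?P = "{p. p permutes L}"
  let ?X = "symbols L"
  let ?u = "map_permutation L S" and ?v = "map_permutation L T"
  let ?g = "\<lambda>i j. b (\<pi> (S i)) (\<pi> (T j))"
  have S: "bij_betw S L (S ` L)" and T: "bij_betw T L (T ` L)"
    by (auto simp: bij_betw_def inj_on_def)
  have injS: "inj_on S L" and injT: "inj_on T L" by (auto simp: inj_on_def)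
  have bij1: "bij_betw (map_prod ?u ?v) (?P \<times> ?P) ({p. p permutes S ` L} \<times> {q. q permutes T ` L})"
    by (intro bij_betw_map_prod bij_betw_map_permutation S T)
  have bij2: "bij_betw (\<lambda>(p, q). p \<circ> q) ({p. p permutes S ` L} \<times> {q. q permutes T ` L})
      {\<rho>. \<rho> permutes ?X \<and> \<rho> ` S ` L = S ` L}"
    unfolding symbols_def by (rule bij_betw_permutes_Un) auto
  have bij3: "bij_betw ((\<circ>) \<pi>) {\<rho>. \<rho> permutes ?X \<and> \<rho> ` S ` L = S ` L}
      {\<rho>. \<rho> permutes ?X \<and> \<rho> ` S ` L = \<pi> ` S ` L}"
  proof (rule bij_betw_byWitness[where f' = "(\<circ>) (inv_into UNIV \<pi>)"])
    have inv: "inv_into UNIV \<pi> \<circ> \<pi> = id" "\<pi> \<circ> inv_into UNIV \<pi> = id"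
      using \<pi> by (simp_all add: permutes_inv_o)
    show "\<forall>a\<in>{\<rho>. \<rho> permutes ?X \<and> \<rho> ` S ` L = S ` L}. inv_into UNIV \<pi> \<circ> (\<pi> \<circ> a) = a"
      "\<forall>a'\<in>{\<rho>. \<rho> permutes ?X \<and> \<rho> ` S ` L = \<pi> ` S ` L}. \<pi> \<circ> (inv_into UNIV \<pi> \<circ> a') = a'"
      by (simp_all only: o_assoc inv id_o) simp_all
    show "(\<circ>) \<pi> ` {\<rho>. \<rho> permutes ?X \<and> \<rho> ` S ` L = S ` L}
      \<subseteq> {\<rho>. \<rho> permutes ?X \<and> \<rho> ` S ` L = \<pi> ` S ` L}"
    proof (rule image_subsetI, rule CollectI, rule conjI)
      fix \<rho> assume \<rho>: "\<rho> \<in> {\<rho>. \<rho> permutes ?X \<and> \<rho> ` S ` L = S ` L}"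
      then show "\<pi> \<circ> \<rho> permutes ?X" using \<pi> by (intro permutes_compose) auto
      show "(\<pi> \<circ> \<rho>) ` S ` L = \<pi> ` S ` L"
        using \<rho> by (simp only: image_comp[symmetric] mem_Collect_eq)
    qed
    show "(\<circ>) (inv_into UNIV \<pi>) ` {\<rho>. \<rho> permutes ?X \<and> \<rho> ` S ` L = \<pi> ` S ` L}
      \<subseteq> {\<rho>. \<rho> permutes ?X \<and> \<rho> ` S ` L = S ` L}"
    proof (rule image_subsetI, rule CollectI, rule conjI)
      fix \<rho> assume \<rho>: "\<rho> \<in> {\<rho>. \<rho> permutes ?X \<and> \<rho> ` S ` L = \<pi> ` S ` L}"
      then show "inv_into UNIV \<pi> \<circ> \<rho> permutes ?X"
        using \<pi> by (intro permutes_compose permutes_inv) auto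
      have "(inv_into UNIV \<pi> \<circ> \<rho>) ` S ` L = (inv_into UNIV \<pi> \<circ> \<pi>) ` S ` L"
        using \<rho> by (simp only: image_comp[symmetric] mem_Collect_eq)
      then show "(inv_into UNIV \<pi> \<circ> \<rho>) ` S ` L = S ` L" by (simp add: inv)
    qed
  qed
  let ?\<Psi> = "\<lambda>(\<sigma>, \<tau>). \<pi> \<circ> (?u \<sigma> \<circ> ?v \<tau>)"
  have bij: "bij_betw ?\<Psi> (?P \<times> ?P) {\<rho>. \<rho> permutes ?X \<and> \<rho> ` S ` L = \<pi> ` S ` L}"
    using bij_betw_trans[OF bij_betw_trans[OF bij1 bij2] bij3]
    by (simp add: comp_def case_prod_unfold)
  have summand: "of_int (sign (?\<Psi> (\<sigma>, \<tau>))) *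
        (\<Prod>i\<in>L. b (?\<Psi> (\<sigma>, \<tau>) (S i)) (?\<Psi> (\<sigma>, \<tau>) (T i))) =
      of_int (sign \<pi>) * (of_int (sign \<sigma> * sign \<tau>) * (\<Prod>i\<in>L. ?g (\<sigma> i) (\<tau> i)))"
    if st: "\<sigma> permutes L" "\<tau> permutes L" for \<sigma> \<tau>
  proof -
    have u: "?u \<sigma> permutes S ` L" and v: "?v \<tau> permutes T ` L"
      using st by (auto intro: map_permutation_permutes S T)
    have "permutation \<pi>" "permutation (?u \<sigma>)" "permutation (?v \<tau>)"
      using L \<pi> u v permutation_permutes finite_symbols finite_imageI by metis+
    then have "sign (?\<Psi> (\<sigma>, \<tau>)) = sign \<pi> * (sign (?u \<sigma>) * sign (?v \<tau>))"
      by (simp add: sign_compose permutation_compose)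
    moreover have "sign (?u \<sigma>) = sign \<sigma>" "sign (?v \<tau>) = sign \<tau>"
      using st L by (auto intro: sign_map_permutation injS injT)
    moreover have "?\<Psi> (\<sigma>, \<tau>) (S i) = \<pi> (S (\<sigma> i))" "?\<Psi> (\<sigma>, \<tau>) (T i) = \<pi> (T (\<tau> i))" if "i \<in> L" for i
    proof -
      have "?v \<tau> (S i) = S i" using v by (rule permutes_not_in) auto
      moreover have "?u \<sigma> (T (\<tau> i)) = T (\<tau> i)" using u by (rule permutes_not_in) auto
      ultimately show "?\<Psi> (\<sigma>, \<tau>) (S i) = \<pi> (S (\<sigma> i))" "?\<Psi> (\<sigma>, \<tau>) (T i) = \<pi> (T (\<tau> i))"
        using that by (simp_all add: map_permutation_apply injS injT)
    qed
    ultimately show ?thesis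
      by (simp add: mult.assoc)
  qed
  have "half_sum b L (\<pi> ` S ` L) = (\<Sum>(\<sigma>, \<tau>)\<in>?P \<times> ?P. of_int (sign (?\<Psi> (\<sigma>, \<tau>))) *
      (\<Prod>i\<in>L. b (?\<Psi> (\<sigma>, \<tau>) (S i)) (?\<Psi> (\<sigma>, \<tau>) (T i))))"
    unfolding half_sum_def by (subst sum.reindex_bij_betw[OF bij, symmetric]) (simp add: case_prod_unfold)
  also have "\<dots> = (\<Sum>(\<sigma>, \<tau>)\<in>?P \<times> ?P. of_int (sign \<pi>) *
      (of_int (sign \<sigma> * sign \<tau>) * (\<Prod>i\<in>L. ?g (\<sigma> i) (\<tau> i))))"
    by (rule sum.cong[OF refl]) (use summand in force)
  also have "\<dots> = of_int (sign \<pi>) *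
      (\<Sum>\<sigma>\<in>?P. \<Sum>\<tau>\<in>?P. of_int (sign \<sigma> * sign \<tau>) * (\<Prod>i\<in>L. ?g (\<sigma> i) (\<tau> i)))"
    by (simp only: sum_distrib_left sum.cartesian_product case_prod_unfold)
  also have "(\<Sum>\<sigma>\<in>?P. \<Sum>\<tau>\<in>?P. of_int (sign \<sigma> * sign \<tau>) * (\<Prod>i\<in>L. ?g (\<sigma> i) (\<tau> i))) =
      (\<Sum>\<sigma>\<in>?P. det_on L ?g)"
  proof (rule sum.cong[OF refl])
    fix \<sigma> assume "\<sigma> \<in> ?P"
    then have \<sigma>: "\<sigma> permutes L" by simp
    have "(\<Sum>\<tau>\<in>?P. of_int (sign \<sigma> * sign \<tau>) * (\<Prod>i\<in>L. ?g (\<sigma> i) (\<tau> i))) =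
        (\<Sum>\<tau>\<in>?P. of_int (sign \<sigma> * sign (\<tau> \<circ> \<sigma>)) * (\<Prod>i\<in>L. ?g (\<sigma> i) ((\<tau> \<circ> \<sigma>) i)))"
      by (rule sum_permutations_compose_right[OF \<sigma>])
    also have "\<dots> = (\<Sum>\<tau>\<in>?P. of_int (sign \<tau>) * (\<Prod>i\<in>L. ?g i (\<tau> i)))"
    proof (rule sum.cong[OF refl])
      fix \<tau> assume "\<tau> \<in> ?P"
      then have "sign \<sigma> * sign (\<tau> \<circ> \<sigma>) = sign \<tau>"
        using \<sigma> L sign_compose[of \<tau> \<sigma>] permutation_permutes by (metis mem_Collect_eq mult.commute mult.left_commute mult.right_neutral sign_idempotent)
      moreover have "(\<Prod>i\<in>L. ?g (\<sigma> i) ((\<tau> \<circ> \<sigma>) i)) = (\<Prod>i\<in>L. ?g i (\<tau> i))"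
        using prod.permute[OF \<sigma>, of "\<lambda>i. ?g i (\<tau> i)"] by (simp add: comp_def)
      ultimately show "of_int (sign \<sigma> * sign (\<tau> \<circ> \<sigma>)) * (\<Prod>i\<in>L. ?g (\<sigma> i) ((\<tau> \<circ> \<sigma>) i)) =
          of_int (sign \<tau>) * (\<Prod>i\<in>L. ?g i (\<tau> i))" by simp
    qed
    finally show "(\<Sum>\<tau>\<in>?P. of_int (sign \<sigma> * sign \<tau>) * (\<Prod>i\<in>L. ?g (\<sigma> i) (\<tau> i))) = det_on L ?g"
      by (simp add: det_on_def)
  qed
  also have "\<dots> = of_nat (fact (card L)) * det_on L ?g"
    using L by (simp add: card_permutations)
  finally show ?thesis .
qed

text \<open>
  The product of the transpositions of \<open>T x\<close> and \<open>S y\<close> over corresponding entries \<open>x\<close> of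
  \<open>xs\<close> and \<open>y\<close> of \<open>ys\<close> moves the symbols indexed by \<open>xs\<close> into the rows and those
  indexed by \<open>ys\<close> into the columns. Each transposition contributes a factor \<open>-1\<close> to the sign.
\<close>

lemma exists_regrouping:
  assumes "length xs = length ys" "distinct xs" "distinct ys" "set xs \<inter> set ys = {}"
  shows "\<exists>\<pi>. \<pi> permutes symbols (set xs \<union> set ys) \<and> sign \<pi> = (-1) ^ length xs \<and>
    (\<forall>r<length xs. \<pi> (S (xs ! r)) = S (xs ! r) \<and> \<pi> (T (xs ! r)) = S (ys ! r) \<and>
      \<pi> (S (ys ! r)) = T (xs ! r) \<and> \<pi> (T (ys ! r)) = T (ys ! r))"
  using assms
proof (induction xs ys rule: list_induct2)
  case Nil
  show ?case by (intro exI[of _ id]) (auto simp only: permutes_id sign_id list.size power_0)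
next
  case (Cons x xs y ys)
  let ?X = "symbols (set xs \<union> set ys)"
  obtain \<pi> where \<pi>: "\<pi> permutes ?X" "sign \<pi> = (-1) ^ length xs"
    and act: "\<And>r. r < length xs \<Longrightarrow> \<pi> (S (xs ! r)) = S (xs ! r) \<and> \<pi> (T (xs ! r)) = S (ys ! r) \<and>
      \<pi> (S (ys ! r)) = T (xs ! r) \<and> \<pi> (T (ys ! r)) = T (ys ! r)"
    using Cons by auto
  let ?\<tau> = "transpose (T x) (S y)"
  have notin: "x \<notin> set xs" "x \<notin> set ys" "y \<notin> set xs" "y \<notin> set ys" "x \<noteq> y"
    using Cons.prems by auto
  have fixed: "\<pi> (S x) = S x" "\<pi> (T x) = T x" "\<pi> (S y) = S y" "\<pi> (T y) = T y"
    using notin by (auto intro!: permutes_not_in[OF \<pi>(1)])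
  have "\<pi> permutes symbols (set (x # xs) \<union> set (y # ys))"
    using \<pi>(1) by (rule permutes_subset) (auto simp: symbols_def)
  then have "?\<tau> \<circ> \<pi> permutes symbols (set (x # xs) \<union> set (y # ys))"
    by (rule permutes_compose) (auto intro: permutes_swap_id)
  moreover have "permutation \<pi>"
    using \<pi>(1) finite_symbols by (metis List.finite_set finite_Un permutation_permutes)
  then have "sign (?\<tau> \<circ> \<pi>) = (-1) ^ length (x # xs)"
    using \<pi>(2) by (simp add: sign_compose permutation_swap_id sign_swap_id)
  moreover have "(?\<tau> \<circ> \<pi>) (S ((x # xs) ! r)) = S ((x # xs) ! r) \<and> (?\<tau> \<circ> \<pi>) (T ((x # xs) ! r)) = S ((y # ys) ! r) \<and>
      (?\<tau> \<circ> \<pi>) (S ((y # ys) ! r)) = T ((x # xs) ! r) \<and> (?\<tau> \<circ> \<pi>) (T ((y # ys) ! r)) = T ((y # ys) ! r)"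
    if "r < length (x # xs)" for r
  proof (cases r)
    case 0
    then show ?thesis using fixed notin by (simp add: transpose_def)
  next
    case (Suc k)
    then have k: "k < length xs" "k < length ys" using that Cons.hyps by auto
    then have "xs ! k \<noteq> x" "xs ! k \<noteq> y" "ys ! k \<noteq> x" "ys ! k \<noteq> y"
      using notin nth_mem by metis+
    then show ?thesis using act[OF k(1)] Suc by (simp add: transpose_def)
  qed
  ultimately show ?case by (intro exI[of _ "?\<tau> \<circ> \<pi>"]) blast
qed

lemma nth_concat_map_pair:
  "r < 2 * length xs \<Longrightarrow> concat (map (\<lambda>i. [f i, g i]) xs) ! r =
     (if even r then f (xs ! (r div 2)) else g (xs ! (r div 2)))"
proof (induction xs arbitrary: r)
  case (Cons x xs)
  consider "r = 0" | "r = 1" | k where "r = Suc (Suc k)"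
    by (metis One_nat_def not0_implies_Suc)
  then show ?case
  proof cases
    case 3
    then show ?thesis using Cons.IH[of k] Cons.prems by auto
  qed auto
qed simp

lemma length_ST_list: "length (ST_list I) = 2 * card I"
  by (simp add: ST_list_def length_concat comp_def sum_list_triv)

definition ST_det :: "(symb \<Rightarrow> symb \<Rightarrow> 'a::comm_ring_1) \<Rightarrow> nat set \<Rightarrow> nat set \<Rightarrow> 'a" where
  "ST_det b I J = det (mat (length (ST_list I)) (length (ST_list J))
     (\<lambda>(i, j). b (ST_list I ! i) (ST_list J ! j)))"

text \<open>
  The sign \<open>(-1) ^ card I\<close> is that of the regrouping permutation. It will cancel the sign
  \<open>(-1) ^ card I\<close> in \<open>sum_half_sum_transversal\<close>, so that all blocks occur with coefficient 1.
\<close>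

lemma half_sum_symbols:
  assumes fin: "finite I" "finite J" and IJ: "I \<inter> J = {}" "card I = card J"
  shows "half_sum b (I \<union> J) (symbols I) =
    (-1) ^ card I * (of_nat (fact (card (I \<union> J))) * ST_det b I J)"
proof -
  define xs ys where "xs = sorted_list_of_set I" and "ys = sorted_list_of_set J"
  define n where "n = card I"
  have len: "length xs = n" "length ys = n" using IJ by (auto simp: xs_def ys_def n_def)
  have dist: "distinct xs" "distinct ys" by (auto simp: xs_def ys_def)
  have set: "set xs = I" "set ys = J" using fin by (auto simp: xs_def ys_def)
  obtain \<pi> where \<pi>: "\<pi> permutes symbols (I \<union> J)" "sign \<pi> = (-1) ^ n"
    and act: "\<And>r. r < n \<Longrightarrow> \<pi> (S (xs ! r)) = S (xs ! r)" "\<And>r. r < n \<Longrightarrow> \<pi> (T (xs ! r)) = S (ys ! r)"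
      "\<And>r. r < n \<Longrightarrow> \<pi> (S (ys ! r)) = T (xs ! r)" "\<And>r. r < n \<Longrightarrow> \<pi> (T (ys ! r)) = T (ys ! r)"
    using exists_regrouping[of xs ys] len dist set IJ by auto
  have nthI: "\<exists>r<n. i = xs ! r" if "i \<in> I" for i
    using that set(1) len(1) by (metis in_set_conv_nth)
  have nthJ: "\<exists>r<n. i = ys ! r" if "i \<in> J" for i
    using that set(2) len(2) by (metis in_set_conv_nth)
  have memI: "xs ! r \<in> I" and memJ: "ys ! r \<in> J" if "r < n" for r
    using that len set by (metis nth_mem)+
  have image: "\<pi> ` S ` (I \<union> J) = symbols I"
  proof
    show "\<pi> ` S ` (I \<union> J) \<subseteq> symbols I"
      using act memI by (auto dest!: nthI nthJ)
    show "symbols I \<subseteq> \<pi> ` S ` (I \<union> J)"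
    proof
      fix u assume "u \<in> symbols I"
      then consider r where "r < n" "u = S (xs ! r)" | r where "r < n" "u = T (xs ! r)"
        unfolding symbols_def using nthI by blast
      then show "u \<in> \<pi> ` S ` (I \<union> J)"
      proof cases
        case 1
        then show ?thesis using act(1) memI by (metis UnI1 imageI)
      next
        case 2
        then show ?thesis using act(3) memJ by (metis UnI2 imageI)
      qed
    qed
  qed
  (* Row r and column r of the block come from the row and the column h r of the regrouped matrix:
     the list of I reads s_x, t_x at the places where the list of J reads s_y, t_y. *)
  define h where "h r = (if even r then xs ! (r div 2) else ys ! (r div 2))" for r
  have h: "bij_betw h {0..<2 * n} (I \<union> J)"
  proof (rule bij_betw_imageI)
    show "inj_on h {0..<2 * n}"
    proof (rule inj_onI)
      fix r s assume rs: "r \<in> {0..<2 * n}" "s \<in> {0..<2 * n}" "h r = h s"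
      then have lt: "r div 2 < n" "s div 2 < n" by auto
      have "even r \<longleftrightarrow> even s"
        using rs(3) memI[OF lt(1)] memI[OF lt(2)] memJ[OF lt(1)] memJ[OF lt(2)] IJ(1)
        by (auto simp: h_def split: if_splits)
      moreover from this have "r div 2 = s div 2"
        using rs(3) lt len dist by (auto simp: h_def nth_eq_iff_index_eq split: if_splits)
      ultimately show "r = s" by (metis even_two_times_div_two odd_two_times_div_two_succ)
    qed
    show "h ` {0..<2 * n} = I \<union> J"
    proof
      show "h ` {0..<2 * n} \<subseteq> I \<union> J" using memI memJ by (auto simp: h_def)
      have "xs ! r = h (2 * r)" "ys ! r = h (2 * r + 1)" for r by (simp_all add: h_def)
      then have "xs ! r \<in> h ` {0..<2 * n}" "ys ! r \<in> h ` {0..<2 * n}" if "r < n" for r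
        using that by (auto intro: image_eqI[where x = "2 * r"] image_eqI[where x = "2 * r + 1"])
      then show "I \<union> J \<subseteq> h ` {0..<2 * n}" by (auto dest!: nthI nthJ)
    qed
  qed
  have entry: "\<pi> (S (h r)) = ST_list I ! r" "\<pi> (T (h r)) = ST_list J ! r" if "r < 2 * n" for r
  proof -
    have "r div 2 < n" using that by auto
    then show "\<pi> (S (h r)) = ST_list I ! r" "\<pi> (T (h r)) = ST_list J ! r"
      using that len act unfolding h_def ST_list_def xs_def[symmetric] ys_def[symmetric]
      by (auto simp: nth_concat_map_pair)
  qed
  have "det_on (I \<union> J) (\<lambda>i j. b (\<pi> (S i)) (\<pi> (T j))) =
      det_on {0..<2 * n} (\<lambda>r s. b (\<pi> (S (h r))) (\<pi> (T (h s))))"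
    by (rule det_on_reindex[OF h]) simp
  also have "\<dots> = det_on {0..<2 * n} (\<lambda>r s. b (ST_list I ! r) (ST_list J ! s))"
    by (rule det_on_cong) (simp add: entry)
  also have "\<dots> = ST_det b I J"
    using IJ(2) unfolding ST_det_def det_def det_on_def length_ST_list n_def
    by (auto intro!: sum.cong arg_cong2[where f = "(*)"] prod.cong simp: permutes_in_image)
  finally show ?thesis
    using half_sum_image[of "I \<union> J" \<pi> b] fin \<pi> image by (simp add: n_def)
qed

definition balanced_det :: "(symb \<Rightarrow> symb \<Rightarrow> 'a::comm_ring_1) \<Rightarrow> nat set \<Rightarrow> 'a" where
  "balanced_det b L = (\<Sum>I | I \<subseteq> L \<and> card I = card (L - I). ST_det b I (L - I))"

text \<open>
  Both sides are evaluations of the two sides of \<open>sum_half_sum_transversal\<close>. Splittings into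
  parts of different size contribute nothing, because a permutation maps the \<open>card L\<close> rows to
  \<open>card L\<close> symbols, whereas \<open>symbols I\<close> has \<open>2 * card I\<close> elements.
\<close>

lemma antisym_det_eq_balanced_det:
  fixes b :: "symb \<Rightarrow> symb \<Rightarrow> 'a::comm_ring_1"
  assumes L: "finite L" and sym: "\<And>u v. b u v = b v u"
  shows "4 ^ card L * (of_nat (fact (card L)) * antisym_det b L) =
    4 ^ card L * (of_nat (fact (card L)) * balanced_det b L)"
proof -
  have "half_sum b L (swap_on A ` S ` L) = of_nat (fact (card L)) *
      ((-1) ^ card A * det_on L (\<lambda>i j. b (swap_on A (S i)) (swap_on A (T j))))" if "A \<in> Pow L" for A
    using that half_sum_image[OF L swap_on_permutes[of A L], of b] L
    by (simp add: sign_swap_on finite_subset mult.left_commute)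
  then have "of_nat (fact (card L)) * antisym_det b L = (\<Sum>A\<in>Pow L. half_sum b L (swap_on A ` S ` L))"
    by (simp add: antisym_det_def sum_distrib_left)
  moreover have "(\<Sum>I\<in>Pow L. (-1) ^ card I * half_sum b L (symbols I)) =
      of_nat (fact (card L)) * balanced_det b L"
    unfolding balanced_det_def sum_distrib_left
  proof (rule sum.mono_neutral_cong_right)
    show "\<forall>I\<in>Pow L - {I. I \<subseteq> L \<and> card I = card (L - I)}. (-1) ^ card I * half_sum b L (symbols I) = 0"
    proof
      fix I assume I: "I \<in> Pow L - {I. I \<subseteq> L \<and> card I = card (L - I)}"
      then have fin: "finite I" "I \<subseteq> L" using L finite_subset by auto
      have "card (symbols I) = card I + card I"
        unfolding symbols_def using fin by (subst card_Un_disjoint) (auto simp: card_image inj_on_def)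
      moreover have "card (L - I) = card L - card I" "card I \<le> card L"
        using L fin by (auto simp: card_Diff_subset card_mono)
      ultimately have "card (symbols I) \<noteq> card L" using I by auto
      then have "half_sum b L (symbols I) = 0"
        by (rule half_sum_eq_0[OF L])
      then show "(-1) ^ card I * half_sum b L (symbols I) = 0"
        by simp
    qed
  next
    fix I assume "I \<in> {I. I \<subseteq> L \<and> card I = card (L - I)}"
    then have I: "I \<subseteq> L" "card I = card (L - I)" by auto
    then have "half_sum b L (symbols I) = (-1) ^ card I * (of_nat (fact (card L)) * ST_det b I (L - I))"
      using half_sum_symbols[of I "L - I" b] L finite_subset by (auto simp: Un_absorb1)
    then show "(-1) ^ card I * half_sum b L (symbols I) = of_nat (fact (card L)) * ST_det b I (L - I)"
      by (simp flip: mult.assoc power_mult_distrib)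
  qed (use L in auto)
  ultimately show ?thesis
    using sum_half_sum_transversal[OF assms] by simp
qed

section \<open>Unfolding the recursion over pairs\<close>

definition supp :: "nat set uprod \<Rightarrow> nat set" where
  "supp p = \<Union> (set_uprod p)"

lemma supp_Upair [simp]: "supp (Upair I J) = I \<union> J"
  by (simp add: supp_def)

definition balanced_pairs :: "nat set \<Rightarrow> nat set uprod set" where
  "balanced_pairs M = {Upair I J | I J.
     I \<noteq> {} \<and> J \<noteq> {} \<and> card I = card J \<and> I \<inter> J = {} \<and> I \<union> J \<subseteq> M}"

lemma balanced_pairs_iff: "p \<in> balanced_pairs M \<longleftrightarrow> p \<in> balanced_pairs UNIV \<and> supp p \<subseteq> M"
  unfolding balanced_pairs_def by (auto 4 3)

lemma finite_balanced_pairs: "finite M \<Longrightarrow> finite (balanced_pairs M)"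
  by (rule finite_subset[of _ "case_prod Upair ` (Pow M \<times> Pow M)"])
    (auto simp: balanced_pairs_def image_iff)

lemma supp_nonempty: "p \<in> balanced_pairs M \<Longrightarrow> supp p \<noteq> {}"
  by (auto simp: balanced_pairs_def)

text \<open>
  The same tuples as in \<open>\<D>\<close>, described without an enumeration of their entries and for an
  arbitrary ground set, so that one entry can be removed.
\<close>

definition pair_partitions :: "nat set \<Rightarrow> nat \<Rightarrow> nat set uprod set set" where
  "pair_partitions M k = {P. P \<subseteq> balanced_pairs M \<and> finite P \<and> card P = k \<and>
     (\<forall>p\<in>P. \<forall>q\<in>P. p \<noteq> q \<longrightarrow> supp p \<inter> supp q = {}) \<and> \<Union> (supp ` P) = M}"

lemma finite_pair_partitions: "finite M \<Longrightarrow> finite (pair_partitions M k)"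
  by (rule finite_subset[of _ "Pow (balanced_pairs M)"])
    (auto simp: pair_partitions_def finite_balanced_pairs)

lemma card_of_pair_partition:
  assumes "finite M" "P \<in> pair_partitions M k"
  shows "even (card M)" "2 * k \<le> card M"
proof -
  have P: "P \<subseteq> balanced_pairs M" "finite P" "card P = k"
    "\<forall>p\<in>P. \<forall>q\<in>P. p \<noteq> q \<longrightarrow> supp p \<inter> supp q = {}" "\<Union> (supp ` P) = M"
    using assms(2) by (auto simp: pair_partitions_def)
  have p: "even (card (supp p)) \<and> 2 \<le> card (supp p) \<and> finite (supp p)" if "p \<in> P" for p
  proof -
    obtain I J where IJ: "p = Upair I J" "I \<noteq> {}" "card I = card J" "I \<inter> J = {}" "I \<union> J \<subseteq> M"
      using P(1) \<open>p \<in> P\<close> unfolding balanced_pairs_def by blast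
    have fin: "finite I" "finite J" using IJ(5) assms(1) by (auto intro: finite_subset)
    have "card (supp p) = 2 * card I" using IJ fin by (simp add: card_Un_disjoint)
    moreover have "card I \<noteq> 0" using IJ(2) fin by simp
    ultimately have "even (card (supp p)) \<and> 2 \<le> card (supp p)" by presburger
    then show ?thesis using IJ(1) fin by simp
  qed
  have M: "card M = (\<Sum>p\<in>P. card (supp p))"
    unfolding P(5)[symmetric] using P(2,4) p by (intro card_UN_disjoint) auto
  show "even (card M)" unfolding M using p by (intro dvd_sum) blast
  have "(\<Sum>p\<in>P. 2) \<le> (\<Sum>p\<in>P. card (supp p))" using p by (intro sum_mono) blast
  then show "2 * k \<le> card M" using M P(3) by simp
qed

lemma insert_pair_partition:
  assumes p: "p \<in> balanced_pairs M" and P: "P \<in> pair_partitions (M - supp p) k"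
  shows "p \<notin> P" "insert p P \<in> pair_partitions M (Suc k)"
proof -
  have P': "P \<subseteq> balanced_pairs (M - supp p)" "finite P" "card P = k"
    "\<forall>p\<in>P. \<forall>q\<in>P. p \<noteq> q \<longrightarrow> supp p \<inter> supp q = {}" "\<Union> (supp ` P) = M - supp p"
    using P by (auto simp: pair_partitions_def)
  have supp: "supp p \<subseteq> M" "supp p \<noteq> {}"
    using p balanced_pairs_iff supp_nonempty by blast+
  have disj: "supp p \<inter> supp q = {}" if "q \<in> P" for q using P'(5) that by blast
  then show p_notin: "p \<notin> P" using supp by blast
  have "P \<subseteq> balanced_pairs M"
  proof
    fix q assume "q \<in> P"
    then show "q \<in> balanced_pairs M"
      using P'(1) balanced_pairs_iff[of q "M - supp p"] balanced_pairs_iff[of q M] by blast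
  qed
  then show "insert p P \<in> pair_partitions M (Suc k)"
    unfolding pair_partitions_def using p P' p_notin supp(1) disj by (simp add: Int_commute) blast
qed

lemma remove_pair_partition:
  assumes P: "P \<in> pair_partitions M (Suc k)" and p: "p \<in> P"
  shows "p \<in> balanced_pairs M" "P - {p} \<in> pair_partitions (M - supp p) k"
proof -
  have P': "P \<subseteq> balanced_pairs M" "finite P" "card P = Suc k"
    "\<forall>p\<in>P. \<forall>q\<in>P. p \<noteq> q \<longrightarrow> supp p \<inter> supp q = {}" "\<Union> (supp ` P) = M"
    using P by (auto simp: pair_partitions_def)
  show "p \<in> balanced_pairs M" using P' p by blast
  have un: "\<Union> (supp ` (P - {p})) = M - supp p"
    using P'(4,5) p by blast
  have "P - {p} \<subseteq> balanced_pairs (M - supp p)"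
  proof
    fix q assume q: "q \<in> P - {p}"
    then have "supp q \<subseteq> M - supp p" using un by blast
    then show "q \<in> balanced_pairs (M - supp p)"
      using P'(1) q balanced_pairs_iff[of q "M - supp p"] balanced_pairs_iff[of q M] by blast
  qed
  then show "P - {p} \<in> pair_partitions (M - supp p) k"
    unfolding pair_partitions_def using P' p un by simp
qed

definition pair_sum :: "(nat set uprod \<Rightarrow> 'a::comm_ring_1) \<Rightarrow> nat set \<Rightarrow> nat \<Rightarrow> 'a" where
  "pair_sum w M k = (\<Sum>P\<in>pair_partitions M k. \<Prod>p\<in>P. w p)"

text \<open>
  Both sides count tuples of \<open>Suc k\<close> pairs with one pair marked.
\<close>

lemma pair_sum_Suc:
  assumes "finite M"
  shows "of_nat (Suc k) * pair_sum w M (Suc k) =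
    (\<Sum>p\<in>balanced_pairs M. w p * pair_sum w (M - supp p) k)"
proof -
  have "of_nat (Suc k) * pair_sum w M (Suc k) =
      (\<Sum>P\<in>pair_partitions M (Suc k). \<Sum>p\<in>P. \<Prod>q\<in>P. w q)"
    unfolding pair_sum_def sum_distrib_left by (rule sum.cong) (auto simp: pair_partitions_def)
  also have "\<dots> = (\<Sum>(P, p)\<in>Sigma (pair_partitions M (Suc k)) (\<lambda>P. P). \<Prod>q\<in>P. w q)"
    using assms by (intro sum.Sigma finite_pair_partitions) (auto simp: pair_partitions_def)
  also have "\<dots> = (\<Sum>(p, P)\<in>Sigma (balanced_pairs M) (\<lambda>p. pair_partitions (M - supp p) k).
      w p * (\<Prod>q\<in>P. w q))"
  proof (rule sum.reindex_bij_witness[where i = "\<lambda>(p, P). (insert p P, p)"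
        and j = "\<lambda>(P, p). (p, P - {p})"], goal_cases)
    case (2 x)
    then show ?case using remove_pair_partition by (auto split: prod.splits)
  next
    case (3 x)
    then show ?case using insert_pair_partition(1) by (auto split: prod.splits)
  next
    case (4 x)
    then show ?case using insert_pair_partition(2) by (auto split: prod.splits)
  next
    case (5 x)
    then obtain P p where x: "x = (P, p)" "P \<in> pair_partitions M (Suc k)" "p \<in> P" by auto
    then have "finite P" by (auto simp: pair_partitions_def)
    then show ?case using x by (simp add: prod.remove)
  qed auto
  also have "\<dots> = (\<Sum>p\<in>balanced_pairs M. \<Sum>P\<in>pair_partitions (M - supp p) k. w p * (\<Prod>q\<in>P. w q))"
    using assms by (intro sum.Sigma[symmetric] finite_balanced_pairs)
      (auto intro: finite_pair_partitions)
  finally show ?thesis by (simp add: pair_sum_def sum_distrib_left)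
qed

lemma pair_sum_empty: "pair_sum w {} 0 = 1" "pair_sum w {} (Suc k) = 0"
proof -
  have "pair_partitions {} 0 = {{}}" by (auto simp: pair_partitions_def)
  then show "pair_sum w {} 0 = 1" by (simp add: pair_sum_def)
  have "pair_partitions {} (Suc k) = {}"
    by (auto simp: pair_partitions_def balanced_pairs_def)
  then show "pair_sum w {} (Suc k) = 0" by (simp add: pair_sum_def)
qed

lemma pair_sum_0: "M \<noteq> {} \<Longrightarrow> pair_sum w M 0 = 0"
proof -
  assume "M \<noteq> {}"
  then have "pair_partitions M 0 = {}" by (auto simp: pair_partitions_def)
  then show ?thesis by (simp add: pair_sum_def)
qed

text \<open>
  The set \<open>L\<close> is the union of the pair. A pair \<open>{I, J}\<close> of disjoint non-empty sets has exactly
  two orderings.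
\<close>

lemma sum_ordered_balanced_pairs:
  fixes F :: "nat set uprod \<Rightarrow> 'a::comm_ring_1"
  assumes "finite M"
  shows "(\<Sum>L\<in>Pow M - {{}}. \<Sum>I | I \<subseteq> L \<and> card I = card (L - I). F (Upair I (L - I))) =
    2 * (\<Sum>p\<in>balanced_pairs M. F p)"
proof -
  define R where "R = {(I, J). I \<noteq> {} \<and> J \<noteq> {} \<and> card I = card J \<and> I \<inter> J = {} \<and> I \<union> J \<subseteq> M}"
  have finR: "finite R"
    by (rule finite_subset[of _ "Pow M \<times> Pow M"]) (use assms in \<open>auto simp: R_def\<close>)
  have "(\<Sum>L\<in>Pow M - {{}}. \<Sum>I | I \<subseteq> L \<and> card I = card (L - I). F (Upair I (L - I))) =
    (\<Sum>(L, I)\<in>Sigma (Pow M - {{}}) (\<lambda>L. {I. I \<subseteq> L \<and> card I = card (L - I)}). F (Upair I (L - I)))"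
  proof (intro sum.Sigma ballI)
    fix L assume "L \<in> Pow M - {{}}"
    then have "finite (Pow L)" using assms finite_subset by auto
    then show "finite {I. I \<subseteq> L \<and> card I = card (L - I)}" by (rule rev_finite_subset) auto
  qed (use assms in simp)
  also have "\<dots> = (\<Sum>(I, J)\<in>R. F (Upair I J))"
  proof (rule sum.reindex_bij_witness[where i = "\<lambda>(I, J). (I \<union> J, I)" and j = "\<lambda>(L, I). (I, L - I)"], goal_cases)
    case (2 x)
    then obtain L I where x: "x = (L, I)" and *: "L \<subseteq> M" "I \<subseteq> L" "card I = card (L - I)" "L \<noteq> {}"
      by auto
    have fin: "finite L" "finite I" using * assms finite_subset by metis+
    have "I \<noteq> {}"
    proof
      assume "I = {}"
      then have "card L = 0" using *(3) by simp
      then show False using *(4) fin(1) by simp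
    qed
    moreover from this have "L - I \<noteq> {}" using *(3) fin by (metis card.empty card_0_eq)
    ultimately show ?case using * x by (auto simp: R_def)
  next
    case (4 x)
    then obtain I J where x: "x = (I, J)" "(I, J) \<in> R" by (cases x) auto
    moreover from this have "I \<union> J - I = J" by (auto simp: R_def)
    ultimately show ?case by (auto simp: R_def)
  qed (auto simp: R_def)
  also have "\<dots> = (\<Sum>x\<in>R. F (case_prod Upair x))" by (simp add: case_prod_unfold)
  also have "\<dots> = (\<Sum>p\<in>balanced_pairs M. \<Sum>x | x \<in> R \<and> case_prod Upair x = p. F (case_prod Upair x))"
    using finR finite_balanced_pairs[OF assms]
    by (rule sum.group[symmetric]) (auto simp: R_def balanced_pairs_def)
  also have "\<dots> = (\<Sum>p\<in>balanced_pairs M. 2 * F p)"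
  proof (rule sum.cong[OF refl])
    fix p assume "p \<in> balanced_pairs M"
    then obtain I J where IJ: "p = Upair I J" "I \<noteq> {}" "J \<noteq> {}" "card I = card J" "I \<inter> J = {}" "I \<union> J \<subseteq> M"
      by (auto simp: balanced_pairs_def)
    then have "{x. x \<in> R \<and> case_prod Upair x = p} = {(I, J), (J, I)}" by (auto simp: R_def)
    moreover have "I \<noteq> J" using IJ by auto
    moreover have "F (Upair J I) = F (Upair I J)" by (rule arg_cong[where f = F]) simp
    ultimately show "(\<Sum>x | x \<in> R \<and> case_prod Upair x = p. F (case_prod Upair x)) = 2 * F p"
      using IJ(1) by simp
  qed
  finally show ?thesis by (simp add: sum_distrib_left)
qed

lemma balanced_det_odd: "odd (card L) \<Longrightarrow> finite L \<Longrightarrow> balanced_det b L = 0"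
proof -
  assume L: "odd (card L)" "finite L"
  have "{I. I \<subseteq> L \<and> card I = card (L - I)} = {}"
  proof safe
    fix I assume I: "I \<subseteq> L" "card I = card (L - I)"
    have "card L = card I + card (L - I)"
      using L(2) I(1) by (metis card_Diff_subset card_mono finite_subset le_add_diff_inverse)
    then show "I \<in> {}" using I(2) L(1) by simp
  qed
  then show ?thesis unfolding balanced_det_def by (metis sum.empty)
qed

text \<open>
  This is the relation \<open>sum_antisym_per_antisym_det\<close> solved for the term \<open>K = {}\<close>. The signs
  \<open>(-1) ^ card K\<close> disappear because only sets of even size contribute.
\<close>

lemma antisym_per_rec:
  assumes M: "finite M" "M \<noteq> {}"
    and D: "\<And>L. finite L \<Longrightarrow> antisym_det b L = balanced_det b L"
    and w: "\<And>I J. w (Upair I J) = ST_det b I J"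
  shows "antisym_per b M = - 2 * (\<Sum>p\<in>balanced_pairs M. w p * antisym_per b (M - supp p))"
proof -
  have E: "(-1) ^ card L * antisym_det b L = balanced_det b L" if "finite L" for L
    using D[OF that] balanced_det_odd[of L b] that by (cases "even (card L)") auto
  have one: "antisym_det b {} = 1" by (simp add: antisym_det_def)
  have "0 = (\<Sum>L\<in>Pow M. (-1) ^ card L * (antisym_per b (M - L) * antisym_det b L))"
    by (rule sum_antisym_per_antisym_det[OF M, symmetric])
  also have "\<dots> = antisym_per b M +
      (\<Sum>L\<in>Pow M - {{}}. (-1) ^ card L * (antisym_per b (M - L) * antisym_det b L))"
    using M(1) by (subst sum.remove[of _ "{}"]) (auto simp: one)
  also have "(\<Sum>L\<in>Pow M - {{}}. (-1) ^ card L * (antisym_per b (M - L) * antisym_det b L)) =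
      (\<Sum>L\<in>Pow M - {{}}. \<Sum>I | I \<subseteq> L \<and> card I = card (L - I).
        w (Upair I (L - I)) * antisym_per b (M - supp (Upair I (L - I))))"
  proof (rule sum.cong[OF refl])
    fix L assume "L \<in> Pow M - {{}}"
    then have "finite L" using M(1) finite_subset by auto
    then have "(-1) ^ card L * (antisym_per b (M - L) * antisym_det b L) =
        balanced_det b L * antisym_per b (M - L)"
      by (simp add: E[symmetric] mult_ac)
    also have "\<dots> = (\<Sum>I | I \<subseteq> L \<and> card I = card (L - I).
        w (Upair I (L - I)) * antisym_per b (M - supp (Upair I (L - I))))"
      unfolding balanced_det_def sum_distrib_right
      by (rule sum.cong) (auto simp: w Un_absorb1)
    finally show "(-1) ^ card L * (antisym_per b (M - L) * antisym_det b L) = \<dots>" .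
  qed
  also have "\<dots> = 2 * (\<Sum>p\<in>balanced_pairs M. w p * antisym_per b (M - supp p))"
    by (rule sum_ordered_balanced_pairs[OF M(1)])
  finally show ?thesis by (simp add: eq_neg_iff_add_eq_0)
qed

text \<open>
  Both sides satisfy the recursion of \<open>antisym_per_rec\<close>: the factor \<open>-2\<close> of the recursion
  raises the power of \<open>-2\<close>, and \<open>pair_sum_Suc\<close> turns \<open>k!\<close> into \<open>(k+1)!\<close>. The bound
  \<open>n\<close> may be any number that is large enough, which keeps the range of summation fixed when pairs
  are removed.
\<close>

lemma antisym_per_eq_pair_sums:
  assumes D: "\<And>L. finite L \<Longrightarrow> antisym_det b L = balanced_det b L"
    and w: "\<And>I J. w (Upair I J) = ST_det b I J"
    and "finite M" "card M \<le> n"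
  shows "antisym_per b M = (\<Sum>k\<le>n. (-2) ^ k * (of_nat (fact k) * pair_sum w M k))"
  using assms(3,4)
proof (induction n arbitrary: M)
  case 0
  then have "M = {}" by simp
  then show ?case by (simp add: antisym_per_def pair_sum_empty)
next
  case (Suc n)
  let ?t = "\<lambda>M k. (-2) ^ k * (of_nat (fact k) * pair_sum w M k)"
  show ?case
  proof (cases "M = {}")
    case True
    then show ?thesis
      unfolding sum.atMost_Suc_shift by (simp add: antisym_per_def pair_sum_empty)
  next
    case False
    have IH: "antisym_per b (M - supp p) = (\<Sum>k\<le>n. ?t (M - supp p) k)" if "p \<in> balanced_pairs M" for p
    proof (rule Suc.IH)
      have "supp p \<subseteq> M" "supp p \<noteq> {}"
        using that balanced_pairs_iff supp_nonempty by blast+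
      then have "card (M - supp p) < card M"
        using Suc.prems(1) by (intro psubset_card_mono) auto
      then show "card (M - supp p) \<le> n" using Suc.prems(2) by simp
    qed (use Suc.prems in auto)
    have "antisym_per b M = - 2 * (\<Sum>p\<in>balanced_pairs M. \<Sum>k\<le>n. w p * ?t (M - supp p) k)"
      by (simp add: antisym_per_rec[OF Suc.prems(1) False D w] IH sum_distrib_left)
    also have "\<dots> = (\<Sum>k\<le>n. (-2) ^ Suc k * (of_nat (fact k) *
        (\<Sum>p\<in>balanced_pairs M. w p * pair_sum w (M - supp p) k)))"
      by (subst sum.swap) (simp add: sum_distrib_left mult_ac)
    also have "\<dots> = (\<Sum>k\<le>n. ?t M (Suc k))"
      by (simp only: pair_sum_Suc[OF Suc.prems(1), symmetric] fact_Suc of_nat_mult mult_ac of_nat_id)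
    also have "\<dots> = (\<Sum>k\<le>Suc n. ?t M k)"
      unfolding sum.atMost_Suc_shift by (simp add: pair_sum_0[OF False])
    finally show ?thesis .
  qed
qed

section \<open>The group of flips and its action on polynomials\<close>

lemma swap_on_comp: "swap_on A \<circ> swap_on B = swap_on (sym_diff A B)"
proof
  fix x show "(swap_on A \<circ> swap_on B) x = swap_on (sym_diff A B) x" by (cases x) auto
qed

lemma flip_eq_swap_on: "flip i = swap_on {i}"
  using swap_on_insert[of i "{}"] by simp

lemma inj_swap_on: "inj swap_on"
proof (rule injI)
  fix A B assume *: "swap_on A = swap_on B"
  have "i \<in> A \<longleftrightarrow> i \<in> B" for i
    using fun_cong[OF *, of "S i"] by (auto split: if_splits)
  then show "A = B" by blast
qed

lemma bij_swap_on: "bij (swap_on A)"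
  using permutes_bij[OF swap_on_permutes[OF order_refl]] .

lemma symbols_lists: "set (S_list m) \<union> set (T_list m) = symbols {1..m}"
  by (auto simp: S_list_def T_list_def symbols_def)

lemma mult_G_grp: "mult (G_grp m) = (\<circ>)"
  by (simp add: G_grp_def Let_def perm_group_def)

lemma carrier_G_grp: "carrier (G_grp m) = swap_on ` Pow {1..m}"
proof -
  let ?P = "perm_group (symbols {1..m})"
  let ?G = "generate ?P (flip ` {1..m})"
  interpret P: group ?P by (rule group_perm_group)
  have ops: "mult ?P = (\<circ>)" "one ?P = id" by (simp_all add: perm_group_def)
  have inv: "inv\<^bsub>?P\<^esub> (flip i) = flip i" if "i \<in> {1..m}" for i
  proof (rule P.inv_equality)
    show "flip i \<otimes>\<^bsub>?P\<^esub> flip i = \<one>\<^bsub>?P\<^esub>"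
      unfolding ops flip_eq_swap_on swap_on_comp by simp
    show "flip i \<in> carrier ?P"
      using that swap_on_permutes[of "{i}" "{1..m}"] by (simp add: perm_group_def flip_eq_swap_on)
    then show "flip i \<in> carrier ?P" .
  qed
  have "g \<in> swap_on ` Pow {1..m}" if "g \<in> ?G" for g
    using that
  proof (induction rule: generate.induct)
    case one
    show ?case unfolding ops by (rule image_eqI[of _ _ "{}"]) simp_all
  next
    case (incl h)
    then show ?case by (auto simp: flip_eq_swap_on)
  next
    case (inv h)
    then obtain i where i: "i \<in> {1..m}" "h = flip i" by auto
    show ?case unfolding i(2) \<open>\<And>i. i \<in> {1..m} \<Longrightarrow> inv\<^bsub>?P\<^esub> (flip i) = flip i\<close>[OF i(1)]
      using i(1) by (auto simp: flip_eq_swap_on)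
  next
    case (eng h1 h2)
    then obtain A B where "A \<subseteq> {1..m}" "h1 = swap_on A" "B \<subseteq> {1..m}" "h2 = swap_on B" by auto
    then show ?case unfolding ops by (intro image_eqI[where x = "sym_diff A B"]) (auto simp: swap_on_comp)
  qed
  moreover have "swap_on A \<in> ?G" if "A \<subseteq> {1..m}" for A
  proof -
    have "finite A" using that finite_subset by blast
    then show ?thesis using that
    proof (induction A rule: finite_induct)
      case empty
      show ?case unfolding swap_on_empty ops(2)[symmetric] by (rule generate.one)
    next
      case (insert i A)
      then have "flip i \<otimes>\<^bsub>?P\<^esub> swap_on A \<in> ?G"
        by (intro generate.eng[OF generate.incl]) auto
      then show ?case using insert.hyps(2) by (simp only: ops swap_on_insert[OF insert.hyps(2)])
    qed
  qed
  ultimately have "?G = swap_on ` Pow {1..m}" by blast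
  then show ?thesis by (simp add: G_grp_def Let_def symbols_lists)
qed

lemma character_swap_on:
  assumes \<chi>: "\<chi> \<in> hom (G_grp m) sign_img" and neg: "\<forall>i\<in>{1..m}. \<chi> (flip i) = -1"
    and "A \<subseteq> {1..m}"
  shows "\<chi> (swap_on A) = (-1) ^ card A"
proof -
  have mult: "\<chi> (swap_on A \<circ> swap_on B) = \<chi> (swap_on A) * \<chi> (swap_on B)"
    if "A \<subseteq> {1..m}" "B \<subseteq> {1..m}" for A B
  proof -
    have "swap_on A \<in> carrier (G_grp m)" "swap_on B \<in> carrier (G_grp m)"
      using that by (auto simp: carrier_G_grp)
    then have "\<chi> (swap_on A \<otimes>\<^bsub>G_grp m\<^esub> swap_on B) = \<chi> (swap_on A) \<otimes>\<^bsub>sign_img\<^esub> \<chi> (swap_on B)"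
      using \<chi> by (rule hom_mult[rotated])
    then show ?thesis by (simp add: mult_G_grp sign_img_def)
  qed
  have "swap_on {} \<in> carrier (G_grp m)" unfolding carrier_G_grp by blast
  then have "\<chi> (swap_on {}) \<in> carrier sign_img" using \<chi> unfolding hom_def by blast
  then have "\<chi> id = 1 \<or> \<chi> id = -1" by (auto simp: sign_img_def)
  moreover have "\<chi> id = \<chi> id * \<chi> id"
    using mult[of "{}" "{}"] unfolding swap_on_empty comp_id by blast
  ultimately have one: "\<chi> id = 1" by auto
  have "finite A" using assms(3) finite_subset by blast
  then show ?thesis using assms(3)
  proof (induction A rule: finite_induct)
    case empty
    show ?case unfolding swap_on_empty one by simp
  next
    case (insert i A)
    then have "\<chi> (swap_on (insert i A)) = \<chi> (flip i) * \<chi> (swap_on A)"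
      using mult[of "{i}" A] by (simp only: swap_on_insert[OF insert.hyps(2)] flip_eq_swap_on) simp
    then show ?case using insert neg by simp
  qed
qed

lemma act_0: "bij g \<Longrightarrow> act g 0 = 0"
  using act_add[of g 0 0] by simp

lemma act_sum: "bij g \<Longrightarrow> act g (\<Sum>x\<in>A. f x) = (\<Sum>x\<in>A. act g (f x))"
  by (induction A rule: infinite_finite_induct) (simp_all add: act_0 act_add)

lemma act_prod: "bij g \<Longrightarrow> act g (\<Prod>x\<in>A. f x) = (\<Prod>x\<in>A. act g (f x))"
  by (induction A rule: infinite_finite_induct) (simp_all add: act_1 act_mult)

lemma per_on_reindex:
  assumes h: "bij_betw h A B"
  shows "per_on B f = per_on A (\<lambda>i j. f (h i) (h j))"
proof -
  have inj: "inj_on h A" and B: "B = h ` A" using h by (simp_all add: bij_betw_def)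
  show ?thesis
    unfolding per_on_def
    by (subst sum.reindex_bij_betw[OF bij_betw_map_permutation[OF h], symmetric])
      (auto intro!: sum.cong simp: B prod.reindex[OF inj] map_permutation_apply[OF inj])
qed

lemma permanent_Bmat: "permanent (Bmat (S_list m) (T_list m)) = per_on {1..m} (\<lambda>i j. bvar (S i) (T j))"
proof -
  have len: "length (S_list m) = m" "length (T_list m) = m" by (simp_all add: S_list_def T_list_def)
  have nth: "S_list m ! i = S (Suc i)" "T_list m ! i = T (Suc i)" if "i < m" for i
    using that by (simp_all add: S_list_def T_list_def del: upt_Suc)
  have zero_based: "permanent (Bmat (S_list m) (T_list m)) = per_on {0..<m} (\<lambda>i j. bvar (S (Suc i)) (T (Suc j)))"
  proof -
    have dim: "dim_row (Bmat (S_list m) (T_list m)) = m" "dim_col (Bmat (S_list m) (T_list m)) = m"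
      by (simp_all add: Bmat_def len)
    have entry: "Bmat (S_list m) (T_list m) $$ (i, p i) = bvar (S (Suc i)) (T (Suc (p i)))"
      if "p permutes {0..<m}" "i \<in> {0..<m}" for p i
    proof -
      have "i < m" "p i < m" using that permutes_in_image[OF that(1), of i] by auto
      then show ?thesis by (simp add: Bmat_def len nth)
    qed
    show ?thesis
      unfolding permanent_def per_on_def dim if_P[OF refl]
      by (intro sum.cong prod.cong refl entry) (auto simp only: mem_Collect_eq)
  qed
  have "bij_betw Suc {0..<m} {1..m}"
    by (simp add: bij_betw_def image_Suc_atLeastLessThan atLeastLessThanSuc_atLeastAtMost)
  then have reindex: "per_on {0..<m} (\<lambda>i j. bvar (S (Suc i)) (T (Suc j))) =
      per_on {1..m} (\<lambda>i j. bvar (S i) (T j))"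
    by (rule per_on_reindex[symmetric])
  show ?thesis unfolding zero_based reindex ..
qed

lemma antisym_permanent_eq:
  assumes "\<chi> \<in> hom (G_grp m) sign_img" "\<forall>i\<in>{1..m}. \<chi> (flip i) = -1"
  shows "antisym_permanent m \<chi> = antisym_per bvar {1..m}"
proof -
  have "act (swap_on A) (permanent (Bmat (S_list m) (T_list m))) =
      per_on {1..m} (\<lambda>i j. bvar (swap_on A (S i)) (swap_on A (T j)))" for A
    unfolding permanent_Bmat per_on_def by (simp only: act_sum act_prod act_bvar bij_swap_on)
  then have "antisym_permanent m \<chi> = (\<Sum>A\<in>Pow {1..m}. of_int (\<chi> (swap_on A)) *
      per_on {1..m} (\<lambda>i j. bvar (swap_on A (S i)) (swap_on A (T j))))"
    unfolding antisym_permanent_def carrier_G_grp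
    by (subst sum.reindex[OF inj_on_subset[OF inj_swap_on subset_UNIV]]) (simp only: o_def)
  also have "\<dots> = antisym_per bvar {1..m}"
    unfolding antisym_per_def
    by (rule sum.cong) (simp_all only: character_swap_on[OF assms] Pow_iff of_int_power of_int_minus of_int_1)
  finally show ?thesis .
qed

section \<open>The expansion of the antisymmetrised permanent\<close>

lemma D_eq_pair_partitions: "\<D> m k = pair_partitions {1..m} k"
proof (intro equalityI subsetI)
  fix P assume "P \<in> \<D> m k"
  then obtain I J where P: "P = (\<lambda>l. Upair (I l) (J l)) ` {1..k}"
    and IJ: "\<And>l. l \<in> {1..k} \<Longrightarrow> I l \<noteq> {} \<and> J l \<noteq> {} \<and> card (I l) = card (J l)"
    and disj: "disjoint_family_on (case_sum I J) ({1..k} <+> {1..k})"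
    and un: "(\<Union>l\<in>{1..k}. I l \<union> J l) = {1..m}"
    unfolding \<D>_def mem_Collect_eq by (elim exE conjE) (rule that; simp)
  have dI: "I l \<inter> I l' = {}" and dJ: "J l \<inter> J l' = {}"
    if "l \<in> {1..k}" "l' \<in> {1..k}" "l \<noteq> l'" for l l'
    using disjoint_family_onD[OF disj, of "Inl l" "Inl l'"]
      disjoint_family_onD[OF disj, of "Inr l" "Inr l'"] that by (simp_all add: InlI InrI)
  have dIJ: "I l \<inter> J l' = {}" if "l \<in> {1..k}" "l' \<in> {1..k}" for l l'
    using disjoint_family_onD[OF disj, of "Inl l" "Inr l'"] that by (simp add: InlI InrI)
  have d: "supp (Upair (I l) (J l)) \<inter> supp (Upair (I l') (J l')) = {}"
    if "l \<in> {1..k}" "l' \<in> {1..k}" "l \<noteq> l'" for l l'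
    using dI[OF that] dJ[OF that] dIJ[OF that(1,2)] dIJ[OF that(2,1)] by auto
  have "inj_on (\<lambda>l. Upair (I l) (J l)) {1..k}"
  proof (rule inj_onI, rule ccontr)
    fix l l' assume l: "l \<in> {1..k}" "l' \<in> {1..k}" "Upair (I l) (J l) = Upair (I l') (J l')" "l \<noteq> l'"
    have "supp (Upair (I l) (J l)) = {}" using d[OF l(1,2,4)] l(3) by simp
    then show False using IJ[OF l(1)] by simp
  qed
  then have "card P = k" unfolding P by (simp add: card_image)
  moreover have "P \<subseteq> balanced_pairs {1..m}"
  proof
    fix p assume "p \<in> P"
    then obtain l where l: "l \<in> {1..k}" "p = Upair (I l) (J l)" unfolding P by blast
    have "I l \<union> J l \<subseteq> {1..m}" using l(1) un by blast
    then show "p \<in> balanced_pairs {1..m}"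
      unfolding balanced_pairs_def l(2) mem_Collect_eq using IJ[OF l(1)] dIJ[OF l(1) l(1)]
      by (intro exI[of _ "I l"] exI[of _ "J l"]) simp
  qed
  moreover have "\<forall>p\<in>P. \<forall>q\<in>P. p \<noteq> q \<longrightarrow> supp p \<inter> supp q = {}"
  proof (intro ballI impI)
    fix p q assume "p \<in> P" "q \<in> P" "p \<noteq> q"
    then obtain l l' where "l \<in> {1..k}" "p = Upair (I l) (J l)" "l' \<in> {1..k}" "q = Upair (I l') (J l')" "l \<noteq> l'"
      unfolding P by blast
    then show "supp p \<inter> supp q = {}" using d by blast
  qed
  moreover have "\<Union> (supp ` P) = {1..m}" unfolding P un[symmetric] by simp
  ultimately show "P \<in> pair_partitions {1..m} k"
    unfolding pair_partitions_def P by blast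
next
  fix P assume "P \<in> pair_partitions {1..m} k"
  then have P: "P \<subseteq> balanced_pairs {1..m}" "finite P" "card P = k"
    "\<forall>p\<in>P. \<forall>q\<in>P. p \<noteq> q \<longrightarrow> supp p \<inter> supp q = {}" "\<Union> (supp ` P) = {1..m}"
    by (auto simp: pair_partitions_def)
  obtain e where e: "bij_betw e {1..k} P"
    using ex_bij_betw_nat_finite_1[OF P(2)] P(3) by blast
  have "\<forall>l\<in>{1..k}. \<exists>I J. e l = Upair I J \<and> I \<noteq> {} \<and> J \<noteq> {} \<and> card I = card J \<and> I \<inter> J = {}"
  proof
    fix l assume "l \<in> {1..k}"
    then have "e l \<in> balanced_pairs {1..m}" using bij_betwE[OF e] P(1) by blast
    then show "\<exists>I J. e l = Upair I J \<and> I \<noteq> {} \<and> J \<noteq> {} \<and> card I = card J \<and> I \<inter> J = {}"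
      unfolding balanced_pairs_def by blast
  qed
  then obtain I J where IJ: "\<And>l. l \<in> {1..k} \<Longrightarrow>
      e l = Upair (I l) (J l) \<and> I l \<noteq> {} \<and> J l \<noteq> {} \<and> card (I l) = card (J l) \<and> I l \<inter> J l = {}"
    by metis
  have supp_e: "supp (e l) = I l \<union> J l" if "l \<in> {1..k}" for l
    using IJ[OF that] by simp
  have img: "P = (\<lambda>l. Upair (I l) (J l)) ` {1..k}"
    unfolding bij_betw_imp_surj_on[OF e, symmetric] using IJ by (intro image_cong) auto
  have d: "(I l \<union> J l) \<inter> (I l' \<union> J l') = {}" if l: "l \<in> {1..k}" "l' \<in> {1..k}" "l \<noteq> l'" for l l'
  proof -
    have "e l \<noteq> e l'" using l bij_betw_imp_inj_on[OF e] by (meson inj_onD)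
    then show ?thesis using P(4) bij_betwE[OF e] l supp_e by metis
  qed
  have "disjoint_family_on (case_sum I J) ({1..k} <+> {1..k})"
    unfolding disjoint_family_on_def
  proof (intro ballI impI)
    fix x y assume "x \<in> {1..k} <+> {1..k}" "y \<in> {1..k} <+> {1..k}" "x \<noteq> y"
    then show "case_sum I J x \<inter> case_sum I J y = {}"
    proof (elim PlusE)
      fix l l' assume "l \<in> {1..k}" "l' \<in> {1..k}" "x = Inl l" "y = Inl l'" "x \<noteq> y"
      then show ?thesis using d[of l l'] by auto
    next
      fix l l' assume "l \<in> {1..k}" "l' \<in> {1..k}" "x = Inr l" "y = Inr l'" "x \<noteq> y"
      then show ?thesis using d[of l l'] by auto
    next
      fix l l' assume "l \<in> {1..k}" "l' \<in> {1..k}" "x = Inl l" "y = Inr l'"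
      then show ?thesis using d[of l l'] IJ[of l] by (cases "l = l'") auto
    next
      fix l l' assume "l \<in> {1..k}" "l' \<in> {1..k}" "x = Inr l" "y = Inl l'"
      then show ?thesis using d[of l l'] IJ[of l] by (cases "l = l'") auto
    qed
  qed
  moreover have "(\<Union>l\<in>{1..k}. I l \<union> J l) = {1..m}"
    using P(5) supp_e unfolding bij_betw_imp_surj_on[OF e, symmetric] by auto
  ultimately show "P \<in> \<D> m k"
    unfolding \<D>_def img using IJ by blast
qed

text \<open>
  Torsion-freeness of the polynomial ring allows the factors accumulated by the symmetrisations to
  be cancelled.
\<close>

lemma of_nat_mult_cancel_int_poly:
  fixes x y :: "'k::monoid_add \<Rightarrow>\<^sub>0 int"
  assumes "of_nat n * x = of_nat n * y" "n \<noteq> 0"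
  shows "x = y"
proof (rule poly_mapping_eqI)
  fix k
  have *: "Poly_Mapping.lookup (of_nat n * z) k = of_nat n * Poly_Mapping.lookup z k"
    for z :: "'k \<Rightarrow>\<^sub>0 int" and n
    by (induction n) (simp_all add: lookup_add algebra_simps)
  show "Poly_Mapping.lookup x k = Poly_Mapping.lookup y k"
    using assms *[of n x] *[of n y] by simp
qed

lemma antisym_det_bvar:
  assumes "finite L"
  shows "antisym_det bvar L = balanced_det bvar L"
proof (rule of_nat_mult_cancel_int_poly)
  show "of_nat (4 ^ card L * fact (card L)) * antisym_det bvar L =
      of_nat (4 ^ card L * fact (card L)) * balanced_det bvar L"
    using antisym_det_eq_balanced_det[OF assms bvar_commute]
    by (simp add: mult.assoc)
qed simp

lemma ST_det_bvar: "pair_det (Upair I J) = ST_det bvar I J"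
  by (simp add: pair_det_Upair ST_det_def Bmat_def)

theorem theorem40:
  fixes m :: nat and \<chi> :: "(symb \<Rightarrow> symb) \<Rightarrow> int"
  assumes "m \<ge> 1"
    and "\<chi> \<in> hom (G_grp m) sign_img"
    and "\<forall>i\<in>{1..m}. \<chi> (flip i) = -1"
  shows "(odd m \<longrightarrow> antisym_permanent m \<chi> = 0) \<and>
    (even m \<longrightarrow> antisym_permanent m \<chi> =
      (\<Sum>k = 1..m div 2. (-2) ^ k * of_nat (fact k) * (\<Sum>P\<in>\<D> m k. \<Prod>p\<in>P. pair_det p)))"
proof -
  let ?t = "\<lambda>k. (-2) ^ k * (of_nat (fact k) * pair_sum pair_det {1..m} k)"
  have eq: "antisym_permanent m \<chi> = (\<Sum>k\<le>m. ?t k)"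
    unfolding antisym_permanent_eq[OF assms(2,3)]
    by (rule antisym_per_eq_pair_sums) (simp_all add: antisym_det_bvar ST_det_bvar)
  have zero: "pair_sum pair_det {1..m} k = 0" if "odd m \<or> m < 2 * k" for k
  proof -
    have "pair_partitions {1..m} k = {}"
      using card_of_pair_partition[of "{1..m}" _ k] that by fastforce
    then show ?thesis by (simp add: pair_sum_def)
  qed
  have "(\<Sum>k\<le>m. ?t k) = (\<Sum>k = 1..m div 2. ?t k)"
  proof (rule sum.mono_neutral_right)
    show "\<forall>k\<in>{..m} - {1..m div 2}. ?t k = 0"
    proof
      fix k assume "k \<in> {..m} - {1..m div 2}"
      then have "k = 0 \<or> m < 2 * k" by auto
      then have "pair_sum pair_det {1..m} k = 0"
        using zero[of k] pair_sum_0[of "{1..m}" pair_det] assms(1) by auto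
      then show "?t k = 0" by simp
    qed
  qed auto
  moreover have "(\<Sum>k\<le>m. ?t k) = 0" if "odd m" using that zero by simp
  ultimately show ?thesis
    unfolding eq by (simp add: pair_sum_def D_eq_pair_partitions mult.assoc)
qed

end
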